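(* Let $(p_i)_{i=1}^\infty$ be a sequence of prime numbers tending to infinity and let $\Gamma=\bigoplus_{i=1}^\infty\mathbb{Z}_{p_i}$. If $E\subseteq\Gamma$ is a Sidon set, then for every $\varepsilon>0$ there is some $\delta>0$ such that for every finite $F\subseteq E$ there exists a finite subset $H\subseteq F$ with Sidon constant bounded by $1+\varepsilon$ and satisfying $|H|\geq\delta|F|$.
   Context: $\mathbb{Z}_p$ is the cyclic group of order $p$; $\Gamma$ is regarded as a discrete abelian group, and $G$ denotes the compact abelian group whose dual is $\Gamma$. $M(G)$ is the space of finite (complex, regular Borel) measures on $G$ with total variation norm, and $\widehat{\mu}$ is the Fourier-Stieltjes transform of $\mu\in M(G)$. A subset $E\subseteq\Gamma$ is a Sidon set if there is a constant $C$ such that for every bounded function $\phi:E\to\mathbb{C}$ there is a measure $\mu\in M(G)$ with $\widehat{\mu}(\gamma)=\phi(\gamma)$ for all $\gamma\in E$ and $\|\mu\|_{M(G)}\leq C\|\phi\|_\infty$. The least such constant $C$ is the Sidon constant of $E$; equivalently, it is the least $C$ such that $\sum_{\gamma\in E}|\widehat{f}(\gamma)|\leq C\sup_{x\in G}|f(x)|$ for every trigonometric polynomial $f$ on $G$ with $\operatorname{supp}\widehat{f}\subseteq E$. $|A|$ denotes the cardinality of a finite set $A$. *)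

theory Defs
  imports "HOL-Analysis.Analysis" "HOL-Algebra.Product_Groups" "HOL-Computational_Algebra.Primes"
begin

section \<open>The dual of a discrete abelian group\<close>

definition circle_group :: "complex monoid" where
  "circle_group = \<lparr>carrier = sphere 0 1, monoid.mult = (*), one = 1\<rparr>"

text \<open>Characters are restricted to the carrier so that each one is represented by exactly one
  function. As the group is discrete, the compact-open topology on its dual is the topology of
  pointwise convergence, that is, the subspace topology from the product.\<close>

definition characters :: "('a, 'b) monoid_scheme \<Rightarrow> ('a \<Rightarrow> complex) set" where
  "characters \<Gamma> = hom \<Gamma> circle_group \<inter> extensional (carrier \<Gamma>)"

definition dual_topology :: "('a, 'b) monoid_scheme \<Rightarrow> ('a \<Rightarrow> complex) topology" where
  "dual_topology \<Gamma> =
     subtopology (product_topology (\<lambda>_. euclidean) (carrier \<Gamma>)) (characters \<Gamma>)"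


section \<open>Complex measures\<close>

definition borel_sets_of :: "'x topology \<Rightarrow> 'x measure" where
  "borel_sets_of X = sigma (topspace X) {U. openin X U}"

text \<open>A complex measure is a countably additive complex function on the measurable sets of
  \<open>M\<close>; here and below only the space and the sigma-algebra of \<open>M\<close> matter.\<close>

definition complex_measure :: "'x measure \<Rightarrow> ('x set \<Rightarrow> complex) \<Rightarrow> bool" where
  "complex_measure M \<mu> \<longleftrightarrow>
     (\<forall>A :: nat \<Rightarrow> 'x set. range A \<subseteq> sets M \<longrightarrow> disjoint_family A \<longrightarrow>
        (\<lambda>n. \<mu> (A n)) sums \<mu> (\<Union>n. A n))"

definition total_variation :: "'x measure \<Rightarrow> ('x set \<Rightarrow> complex) \<Rightarrow> 'x set \<Rightarrow> ennreal" where
  "total_variation M \<mu> A =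
     (SUP P \<in> {P. finite P \<and> disjoint P \<and> P \<subseteq> sets M \<and> \<Union>P = A}.
        \<Sum>B\<in>P. ennreal (cmod (\<mu> B)))"

text \<open>The positive part in the Jordan decomposition of a finite signed measure \<open>\<nu>\<close>;
  the negative part is the positive part of \<open>- \<nu>\<close>. Negative values of \<open>\<nu>\<close> are
  truncated to 0 by \<^const>\<open>ennreal\<close>, which does not affect the supremum, as
  \<open>\<nu> {} = 0\<close>.\<close>

definition jordan_pos :: "'x measure \<Rightarrow> ('x set \<Rightarrow> real) \<Rightarrow> 'x measure" where
  "jordan_pos M \<nu> =
     measure_of (space M) (sets M) (\<lambda>A. SUP B \<in> {B \<in> sets M. B \<subseteq> A}. ennreal (\<nu> B))"

definition signed_integral :: "'x measure \<Rightarrow> ('x set \<Rightarrow> real) \<Rightarrow> ('x \<Rightarrow> complex) \<Rightarrow> complex" where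
  "signed_integral M \<nu> f =
     integral\<^sup>L (jordan_pos M \<nu>) f - integral\<^sup>L (jordan_pos M (\<lambda>A. - \<nu> A)) f"

definition complex_integral :: "'x measure \<Rightarrow> ('x set \<Rightarrow> complex) \<Rightarrow> ('x \<Rightarrow> complex) \<Rightarrow> complex" where
  "complex_integral M \<mu> f =
     signed_integral M (\<lambda>A. Re (\<mu> A)) f + \<i> * signed_integral M (\<lambda>A. Im (\<mu> A)) f"

definition regular_measure :: "'x topology \<Rightarrow> ('x set \<Rightarrow> complex) \<Rightarrow> bool" where
  "regular_measure X \<mu> \<longleftrightarrow>
     (\<forall>A \<in> sets (borel_sets_of X).
        total_variation (borel_sets_of X) \<mu> A =
          (INF U \<in> {U. openin X U \<and> A \<subseteq> U}. total_variation (borel_sets_of X) \<mu> U) \<and>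
        total_variation (borel_sets_of X) \<mu> A =
          (SUP K \<in> {K. compactin X K \<and> K \<subseteq> A}. total_variation (borel_sets_of X) \<mu> K))"


section \<open>Measures on the dual group and Sidon sets\<close>

definition dual_measures :: "('a, 'b) monoid_scheme \<Rightarrow> (('a \<Rightarrow> complex) set \<Rightarrow> complex) set" where
  "dual_measures \<Gamma> =
     {\<mu>. complex_measure (borel_sets_of (dual_topology \<Gamma>)) \<mu> \<and> regular_measure (dual_topology \<Gamma>) \<mu>}"

definition measure_norm ::
    "('a, 'b) monoid_scheme \<Rightarrow> (('a \<Rightarrow> complex) set \<Rightarrow> complex) \<Rightarrow> ennreal" where
  "measure_norm \<Gamma> \<mu> =
     total_variation (borel_sets_of (dual_topology \<Gamma>)) \<mu> (topspace (dual_topology \<Gamma>))"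

definition fourier_stieltjes ::
    "('a, 'b) monoid_scheme \<Rightarrow> (('a \<Rightarrow> complex) set \<Rightarrow> complex) \<Rightarrow> 'a \<Rightarrow> complex" where
  "fourier_stieltjes \<Gamma> \<mu> \<gamma> =
     complex_integral (borel_sets_of (dual_topology \<Gamma>)) \<mu> (\<lambda>x. cnj (x \<gamma>))"

definition sidon_bound :: "('a, 'b) monoid_scheme \<Rightarrow> 'a set \<Rightarrow> real \<Rightarrow> bool" where
  "sidon_bound \<Gamma> E C \<longleftrightarrow>
     0 \<le> C \<and>
     (\<forall>\<phi> :: 'a \<Rightarrow> complex. bounded (\<phi> ` E) \<longrightarrow>
        (\<exists>\<mu> \<in> dual_measures \<Gamma>.
           (\<forall>\<gamma>\<in>E. fourier_stieltjes \<Gamma> \<mu> \<gamma> = \<phi> \<gamma>) \<and>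
           measure_norm \<Gamma> \<mu> \<le> ennreal C * (SUP \<gamma>\<in>E. ennreal (cmod (\<phi> \<gamma>)))))"

definition sidon_set :: "('a, 'b) monoid_scheme \<Rightarrow> 'a set \<Rightarrow> bool" where
  "sidon_set \<Gamma> E \<longleftrightarrow> E \<subseteq> carrier \<Gamma> \<and> (\<exists>C. sidon_bound \<Gamma> E C)"

text \<open>Infinite if there is no admissible constant.\<close>

definition sidon_constant :: "('a, 'b) monoid_scheme \<Rightarrow> 'a set \<Rightarrow> ennreal" where
  "sidon_constant \<Gamma> E = Inf (ennreal ` {C. sidon_bound \<Gamma> E C})"

end

theory Submission
  imports Defs
begin

text \<open>Why the theorem holds. Let \<open>H\<close> be a finite subset of the group, its
  elements regarded as characters of the dual group, that satisfies no nontrivial relation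
  \<open>\<Prod>\<gamma>\<in>H. \<gamma>\<^bsup>r \<gamma>\<^esup> = 1\<close> with coefficients
  \<open>\<bar>r \<gamma>\<bar> \<le> n + 1\<close>. Then the product over \<open>H\<close> of
  the Fejer kernels
  \<open>1 + \<Sum>j=1..n. (1 - j / (n + 1)) (z\<^sup>j + z\<^sup>-\<^sup>j)\<close> at
  \<open>z = u \<gamma> \<gamma>\<close>, with \<open>u\<close> unimodular, is a nonnegative
  function of mean 1 whose coefficient at \<open>\<gamma>\<close> is
  \<open>n / (n + 1) * u \<gamma>\<close> (\<open>riesz_product\<close>). Every function
  bounded by 1 is the midpoint of two unimodular ones, so the Sidon constant of \<open>H\<close> is
  at most \<open>1 + 1 / n\<close> (\<open>independent_interpolation\<close>). It remains to
  find, inside every finite subset \<open>F\<close> of a Sidon set, a set of proportional size that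
  is independent of a prescribed degree \<open>m\<close>.

  By Rudin's averaging over random signs, interpolation with bounded norm makes the exponential
  moments of the sum of \<open>F\<close> subgaussian (\<open>exp_moment\<close>). If the power maps
  \<open>x \<mapsto> x\<^sup>j\<close> with \<open>1 \<le> j \<le> m\<close> preserve the mean
  on the dual group, then so are those of the sum of the powers \<open>\<gamma>\<^sup>j\<close>
  (\<open>exp_moment_powers\<close>), and expanding a product of the form
  \<open>\<Prod>\<gamma>\<in>F. 1 + t * (\<dots>)\<close>, which is at most the corresponding
  exponential, bounds the number of relations: the sum of \<open>t\<^bsup>|supp r|\<^esup>\<close>
  over all relations \<open>r\<close> of degree \<open>m\<close> is at most
  \<open>2 exp(c t\<^sup>2 |F|)\<close> for small \<open>t\<close>
  (\<open>sum_relations_le\<close>). Hence, if \<open>\<delta>\<close> is small and \<open>F\<close>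
  is large, a random subset \<open>A\<close> of density \<open>\<delta>\<close> has with positive
  probability at least \<open>3 / 4 * \<delta> |F|\<close> elements and contains no relation
  whose support has size at least \<open>\<delta> |F| / 4\<close>
  (\<open>large_subset_avoiding\<close>); for small \<open>F\<close> a single element will do.
  Remove from \<open>A\<close> the support of a relation of maximal support. What is left is
  independent of degree \<open>m\<close>: a further relation would have a disjoint support, and the
  sum of the two relations would be a larger one with coefficients of the same size
  (\<open>independent_of_small_supports\<close>).

  The power maps preserve the mean when all orders involved are coprime to
  \<open>1, \<dots>, m\<close>. The primes up to \<open>m\<close> occur in finitely many
  coordinates only, because \<open>p\<close> tends to infinity. So a proportional part of
  \<open>F\<close> is constant in these coordinates, and for \<open>\<gamma>\<close> and a fixed
  \<open>\<beta>\<close> in this part the ratio \<open>x \<gamma> / x \<beta>\<close>, the value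
  of the character \<open>x\<close> at \<open>\<gamma> - \<beta>\<close>, is a root of unity whose
  order has only prime factors above \<open>m\<close>. Translation by \<open>\<beta>\<close>
  multiplies measures by a unimodular function and thus does not affect interpolation.

  Finally, everything happens on a finite set. On finitely many elements of finite order there are
  only finitely many restrictions of characters, so that a measure on the dual group enters only
  through its masses on the fibres of the restriction map
  (\<open>fourier_stieltjes_restriction\<close>), and conversely finite combinations of point masses
  suffice for interpolation (\<open>sidon_boundI\<close>).\<close>

section \<open>Finite groups of unimodular functions\<close>

text \<open>The finite model of a dual group: the elements of \<open>T\<close> are characters, recorded by their values on
  the group elements \<open>\<gamma>\<close> under consideration. A finite set of unimodular functions that is closed
  under products is a group, and its uniform distribution plays the role of Haar measure.\<close>

locale circle_valued_group =
  fixes T :: "('a \<Rightarrow> complex) set"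
  assumes finite_T: "finite T"
    and nonempty_T: "T \<noteq> {}"
    and norm_T: "x \<in> T \<Longrightarrow> cmod (x \<gamma>) = 1"
    and mult_T: "x \<in> T \<Longrightarrow> y \<in> T \<Longrightarrow> (\<lambda>\<gamma>. x \<gamma> * y \<gamma>) \<in> T"
begin

text \<open>Relations are read off from the characters: \<open>r\<close> is a relation if \<open>\<Sum>\<gamma>\<in>A. r \<gamma> \<cdot> \<gamma>\<close> is annihilated by
  all of \<open>T\<close>. In this way the group that contains the \<open>\<gamma>\<close> itself never has to be mentioned.\<close>

definition relation :: "'a set \<Rightarrow> ('a \<Rightarrow> int) \<Rightarrow> bool" where
  "relation A r \<longleftrightarrow> (\<forall>x\<in>T. (\<Prod>\<gamma>\<in>A. x \<gamma> powi r \<gamma>) = 1)"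

definition independent_of_degree :: "nat \<Rightarrow> 'a set \<Rightarrow> bool" where
  "independent_of_degree m H \<longleftrightarrow>
     (\<forall>r. relation H r \<and> (\<forall>\<gamma>\<in>H. \<bar>r \<gamma>\<bar> \<le> int m) \<longrightarrow> (\<forall>\<gamma>\<in>H. r \<gamma> = 0))"

lemma nonzero_T: "x \<in> T \<Longrightarrow> x \<gamma> \<noteq> 0"
  using norm_T[of x \<gamma>] by auto

lemma mult_cnj_T: "x \<in> T \<Longrightarrow> x \<gamma> * cnj (x \<gamma>) = 1"
  using norm_T[of x \<gamma>] by (simp flip: complex_norm_square)

lemma card_T_pos: "card T > 0"
  using finite_T nonempty_T by (simp add: card_gt_0_iff)

lemma bij_betw_translate:
  assumes "y \<in> T"
  shows "bij_betw (\<lambda>x \<gamma>. x \<gamma> * y \<gamma>) T T"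
proof -
  have "inj_on (\<lambda>x \<gamma>. x \<gamma> * y \<gamma>) T"
    using nonzero_T[OF assms] by (auto simp: inj_on_def fun_eq_iff)
  moreover have "(\<lambda>x \<gamma>. x \<gamma> * y \<gamma>) ` T \<subseteq> T"
    using mult_T assms by auto
  ultimately show ?thesis
    using finite_T by (simp add: bij_betw_def endo_inj_surj)
qed

lemma sum_translate:
  assumes "y \<in> T"
  shows "(\<Sum>x\<in>T. g (\<lambda>\<gamma>. x \<gamma> * y \<gamma>)) = (\<Sum>x\<in>T. g x)"
  by (rule sum.reindex_bij_betw[OF bij_betw_translate[OF assms]])

lemma sum_translate_cnj:
  assumes "y \<in> T"
  shows "(\<Sum>x\<in>T. g (\<lambda>\<gamma>. x \<gamma> * cnj (y \<gamma>))) = (\<Sum>x\<in>T. g x)"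
proof -
  have "(\<lambda>\<gamma>. x \<gamma> * y \<gamma> * cnj (y \<gamma>)) = x" for x
    using mult_cnj_T[OF assms] by (simp add: mult.assoc)
  then show ?thesis
    using sum_translate[OF assms, of "\<lambda>x. g (\<lambda>\<gamma>. x \<gamma> * cnj (y \<gamma>))"] by simp
qed

lemma orthogonality:
  "(\<Sum>x\<in>T. \<Prod>\<gamma>\<in>A. x \<gamma> powi r \<gamma>) = (if relation A r then of_nat (card T) else 0)"
proof (cases "relation A r")
  case True
  then show ?thesis by (simp add: relation_def)
next
  case False
  then obtain y where y: "y \<in> T" "(\<Prod>\<gamma>\<in>A. y \<gamma> powi r \<gamma>) \<noteq> 1"
    by (auto simp: relation_def)
  define S where "S = (\<Sum>x\<in>T. \<Prod>\<gamma>\<in>A. x \<gamma> powi r \<gamma>)"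
  have "S = (\<Sum>x\<in>T. \<Prod>\<gamma>\<in>A. (x \<gamma> * y \<gamma>) powi r \<gamma>)"
    unfolding S_def by (rule sum_translate[OF y(1), symmetric])
  also have "\<dots> = S * (\<Prod>\<gamma>\<in>A. y \<gamma> powi r \<gamma>)"
    by (simp add: S_def power_int_mult_distrib prod.distrib sum_distrib_right)
  finally have "S = 0"
    using y(2) by simp
  then show ?thesis
    using False by (simp add: S_def)
qed

text \<open>Multiplying out a product of Laurent polynomials in the values \<open>x \<gamma>\<close> and averaging over \<open>x\<close> leaves
  precisely the terms whose exponents form a relation. This is used twice: for counting relations
  and for computing Fourier coefficients of Riesz products.\<close>

lemma sum_prod_expansion:
  fixes c :: "'a \<Rightarrow> 'i \<Rightarrow> complex" and e :: "'a \<Rightarrow> 'i \<Rightarrow> int"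
  assumes "finite A" "finite I"
  shows "(\<Sum>x\<in>T. \<Prod>\<gamma>\<in>A. \<Sum>i\<in>I. c \<gamma> i * x \<gamma> powi e \<gamma> i) =
           of_nat (card T) *
             (\<Sum>s\<in>{s \<in> A \<rightarrow>\<^sub>E I. relation A (\<lambda>\<gamma>. e \<gamma> (s \<gamma>))}. \<Prod>\<gamma>\<in>A. c \<gamma> (s \<gamma>))"
proof -
  have fin: "finite (A \<rightarrow>\<^sub>E I)"
    using assms by (simp add: finite_PiE)
  have "(\<Sum>x\<in>T. \<Prod>\<gamma>\<in>A. \<Sum>i\<in>I. c \<gamma> i * x \<gamma> powi e \<gamma> i) =
          (\<Sum>x\<in>T. \<Sum>s\<in>A \<rightarrow>\<^sub>E I. \<Prod>\<gamma>\<in>A. c \<gamma> (s \<gamma>) * x \<gamma> powi e \<gamma> (s \<gamma>))"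
    using assms by (simp add: prod_sum_PiE)
  also have "\<dots> = (\<Sum>s\<in>A \<rightarrow>\<^sub>E I. (\<Prod>\<gamma>\<in>A. c \<gamma> (s \<gamma>)) *
                      (\<Sum>x\<in>T. \<Prod>\<gamma>\<in>A. x \<gamma> powi e \<gamma> (s \<gamma>)))"
    by (subst sum.swap) (simp add: prod.distrib sum_distrib_left)
  also have "\<dots> = (\<Sum>s\<in>A \<rightarrow>\<^sub>E I. if relation A (\<lambda>\<gamma>. e \<gamma> (s \<gamma>))
                      then of_nat (card T) * (\<Prod>\<gamma>\<in>A. c \<gamma> (s \<gamma>)) else 0)"
    by (intro sum.cong refl) (simp add: orthogonality)
  also have "\<dots> = (\<Sum>s\<in>{s \<in> A \<rightarrow>\<^sub>E I. relation A (\<lambda>\<gamma>. e \<gamma> (s \<gamma>))}.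
                      of_nat (card T) * (\<Prod>\<gamma>\<in>A. c \<gamma> (s \<gamma>)))"
    using fin by (simp add: sum.inter_filter)
  finally show ?thesis
    by (simp add: sum_distrib_left)
qed

text \<open>On a set that is independent of degree \<open>m\<close>, the coordinates behave like independent uniformly
  distributed variables on the circle as far as Laurent polynomials of degree at most \<open>m\<close> can tell:
  the mean of a product is the product of the constant terms.\<close>

lemma independent_sum_prod:
  fixes c :: "'a \<Rightarrow> 'i \<Rightarrow> complex" and e :: "'a \<Rightarrow> 'i \<Rightarrow> int"
  assumes "independent_of_degree m H" "finite H" "finite I"
    and deg: "\<And>\<gamma> i. \<gamma> \<in> H \<Longrightarrow> i \<in> I \<Longrightarrow> \<bar>e \<gamma> i\<bar> \<le> int m"
  shows "(\<Sum>x\<in>T. \<Prod>\<gamma>\<in>H. \<Sum>i\<in>I. c \<gamma> i * x \<gamma> powi e \<gamma> i) =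
           of_nat (card T) * (\<Prod>\<gamma>\<in>H. \<Sum>i\<in>{i\<in>I. e \<gamma> i = 0}. c \<gamma> i)"
proof -
  have "{s \<in> H \<rightarrow>\<^sub>E I. relation H (\<lambda>\<gamma>. e \<gamma> (s \<gamma>))} = (\<Pi>\<^sub>E \<gamma>\<in>H. {i\<in>I. e \<gamma> i = 0})"
  proof (intro equalityI subsetI)
    fix s assume s: "s \<in> {s \<in> H \<rightarrow>\<^sub>E I. relation H (\<lambda>\<gamma>. e \<gamma> (s \<gamma>))}"
    then have "\<forall>\<gamma>\<in>H. e \<gamma> (s \<gamma>) = 0"
      using assms(1) deg unfolding independent_of_degree_def by (auto simp: PiE_iff)
    with s show "s \<in> (\<Pi>\<^sub>E \<gamma>\<in>H. {i\<in>I. e \<gamma> i = 0})"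
      by (auto simp: PiE_iff)
  qed (auto simp: PiE_iff relation_def)
  then show ?thesis
    using sum_prod_expansion[OF assms(2,3)] assms(2,3) by (simp add: prod_sum_PiE)
qed

end

text \<open>If the exponent \<open>M\<close> of the group is coprime to \<open>j\<close>, an inverse of \<open>j\<close> modulo \<open>M\<close> undoes the \<open>j\<close>-th
  power.\<close>

lemma (in circle_valued_group) bij_betw_power:
  assumes M: "\<And>x \<gamma>. x \<in> T \<Longrightarrow> x \<gamma> ^ M = 1" and j: "1 \<le> j" "coprime j M"
  shows "bij_betw (\<lambda>x \<gamma>. x \<gamma> ^ j) T T"
proof -
  obtain a b where ab: "j * a = M * b + 1"
    using bezout_nat[of j M] j by auto
  have root: "(x \<gamma> ^ j) ^ a = x \<gamma>" if "x \<in> T" for x \<gamma>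
    using M[OF that, of \<gamma>] by (simp add: power_mult[symmetric] ab) (simp add: power_mult)
  have "inj_on (\<lambda>x \<gamma>. x \<gamma> ^ j) T"
  proof (rule inj_onI, rule ext)
    fix x y \<gamma>
    assume "x \<in> T" "y \<in> T" "(\<lambda>\<gamma>. x \<gamma> ^ j) = (\<lambda>\<gamma>. y \<gamma> ^ j)"
    then show "x \<gamma> = y \<gamma>"
      by (metis root)
  qed
  moreover have "(\<lambda>\<gamma>. x \<gamma> ^ j) \<in> T" if "x \<in> T" for x
    using j(1)
  proof (induction j rule: dec_induct)
    case (step j)
    then show ?case using mult_T[OF that, of "\<lambda>\<gamma>. x \<gamma> ^ j"] by simp
  qed (use that in simp)
  ultimately show ?thesis
    using finite_T by (simp add: bij_betw_def endo_inj_surj image_subset_iff)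
qed

section \<open>Exponential moments of character sums\<close>

text \<open>The subgaussian estimate for a single random sign, with a constant that is easy to prove rather
  than the optimal \<open>exp (u\<^sup>2 / 2)\<close>.\<close>

lemma cosh_le_exp_square: "cosh u \<le> exp (u\<^sup>2)" for u :: real
proof -
  define v where "v = \<bar>u\<bar>"
  have "cosh v \<le> exp (v\<^sup>2)"
  proof (cases "v \<le> 1")
    case True
    have v: "0 \<le> v" by (simp add: v_def)
    have "exp (-v) \<le> 1 / (1 + v)"
      using v exp_ge_add_one_self[of v] by (simp add: exp_minus divide_simps)
    also have "\<dots> \<le> 1 - v + v\<^sup>2"
    proof -
      have "(1 - v + v\<^sup>2) * (1 + v) = 1 + v ^ 3"
        by (simp add: algebra_simps power2_eq_square power3_eq_cube)
      then show ?thesis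
        using v by (simp add: pos_divide_le_eq)
    qed
    finally have "cosh v \<le> 1 + v\<^sup>2"
      using exp_bound[OF v True] by (simp add: cosh_def)
    also have "\<dots> \<le> exp (v\<^sup>2)"
      by (rule exp_ge_add_one_self)
    finally show ?thesis .
  next
    case False
    then have "v \<le> v\<^sup>2"
      by (simp add: power2_eq_square)
    then have "exp v \<le> exp (v\<^sup>2)" "exp (-v) \<le> exp (v\<^sup>2)"
      using False by auto
    from divide_right_mono[OF add_mono[OF this], of 2] show ?thesis
      by (simp add: cosh_field_def)
  qed
  then show ?thesis
    by (simp add: v_def abs_if split: if_splits)
qed

lemma sum_signs_exp_le:
  fixes c :: "'a \<Rightarrow> real"
  assumes "finite F" and c: "\<And>\<gamma>. \<gamma> \<in> F \<Longrightarrow> \<bar>c \<gamma>\<bar> \<le> 1"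
  shows "(\<Sum>\<epsilon>\<in>F \<rightarrow>\<^sub>E {-1, 1}. exp (s * (\<Sum>\<gamma>\<in>F. \<epsilon> \<gamma> * c \<gamma>))) \<le> 2 ^ card F * exp (s\<^sup>2 * card F)"
proof -
  have "(\<Sum>\<epsilon>\<in>F \<rightarrow>\<^sub>E {-1, 1}. exp (s * (\<Sum>\<gamma>\<in>F. \<epsilon> \<gamma> * c \<gamma>))) =
          (\<Sum>\<epsilon>\<in>F \<rightarrow>\<^sub>E {-1, 1}. \<Prod>\<gamma>\<in>F. exp (s * (\<epsilon> \<gamma> * c \<gamma>)))"
    using assms(1) by (simp add: exp_sum sum_distrib_left)
  also have "\<dots> = (\<Prod>\<gamma>\<in>F. \<Sum>\<epsilon>\<in>{-1, 1}. exp (s * (\<epsilon> * c \<gamma>)))"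
    using assms(1) by (simp only: prod_sum_PiE finite.emptyI finite.insertI)
  also have "\<dots> = (\<Prod>\<gamma>\<in>F. 2 * cosh (s * c \<gamma>))"
    by (intro prod.cong refl) (simp add: cosh_def field_simps)
  also have "\<dots> \<le> (\<Prod>\<gamma>\<in>F. 2 * exp (s\<^sup>2))"
  proof (intro prod_mono conjI)
    fix \<gamma> assume "\<gamma> \<in> F"
    then have "(c \<gamma>)\<^sup>2 \<le> 1"
      using c by (simp add: abs_square_le_1)
    then have "(s * c \<gamma>)\<^sup>2 \<le> s\<^sup>2"
      by (simp add: power_mult_distrib mult_left_le)
    then show "2 * cosh (s * c \<gamma>) \<le> 2 * exp (s\<^sup>2)"
      using cosh_le_exp_square[of "s * c \<gamma>"] by (smt (verit) exp_le_cancel_iff)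
  qed simp
  also have "\<dots> = 2 ^ card F * exp (s\<^sup>2 * card F)"
    by (simp add: power_mult_distrib exp_of_nat_mult mult.commute)
  finally show ?thesis .
qed

text \<open>Reduces exponential moments of the modulus of a complex random sum to those of its real and
  imaginary parts, to which the estimate for random signs applies.\<close>

lemma exp_cmod_le:
  assumes "0 \<le> a"
  shows "exp (a * cmod z) \<le>
    (exp (2 * a * Re z) + exp (-2 * a * Re z) + exp (2 * a * Im z) + exp (-2 * a * Im z)) / 2"
proof -
  have sq: "exp (a * \<bar>u\<bar>) * exp (a * \<bar>u\<bar>) \<le> exp (2 * a * u) + exp (-2 * a * u)" for u :: real
    by (cases "u \<ge> 0") (simp_all add: mult.assoc flip: exp_add)
  have "exp (a * cmod z) \<le> exp (a * (\<bar>Re z\<bar> + \<bar>Im z\<bar>))"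
    using cmod_le[of z] assms by (simp add: mult_left_mono)
  also have "\<dots> = exp (a * \<bar>Re z\<bar>) * exp (a * \<bar>Im z\<bar>)"
    by (simp add: distrib_left exp_add)
  also have "\<dots> \<le> (exp (a * \<bar>Re z\<bar>) * exp (a * \<bar>Re z\<bar>) + exp (a * \<bar>Im z\<bar>) * exp (a * \<bar>Im z\<bar>)) / 2"
    using sum_squares_bound[of "exp (a * \<bar>Re z\<bar>)" "exp (a * \<bar>Im z\<bar>)"]
    by (simp add: power2_eq_square)
  also have "\<dots> \<le> (exp (2 * a * Re z) + exp (-2 * a * Re z) +
                     (exp (2 * a * Im z) + exp (-2 * a * Im z))) / 2"
    by (intro divide_right_mono add_mono sq) simp
  finally show ?thesis
    by (simp only: add.assoc)
qed

context circle_valued_group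
begin

definition interpolates_signs :: "'a set \<Rightarrow> real \<Rightarrow> bool" where
  "interpolates_signs F C \<longleftrightarrow>
     (\<forall>\<epsilon> :: 'a \<Rightarrow> real. (\<forall>\<gamma>\<in>F. \<epsilon> \<gamma> \<in> {-1, 1}) \<longrightarrow>
        (\<exists>\<nu>. (\<Sum>y\<in>T. cmod (\<nu> y)) \<le> C \<and>
             (\<forall>\<gamma>\<in>F. (\<Sum>y\<in>T. \<nu> y * cnj (y \<gamma>)) = of_real (\<epsilon> \<gamma>))))"

text \<open>If \<open>\<nu>\<close> interpolates the signs \<open>\<epsilon>\<close>, then \<open>\<Sum>\<gamma>\<in>F. x \<gamma>\<close> is the convolution of \<open>\<nu>\<close> with the signed sum
  \<open>\<Sum>\<gamma>\<in>F. \<epsilon> \<gamma> * x \<gamma>\<close>, because \<open>\<epsilon> \<gamma> * \<epsilon> \<gamma> = 1\<close>. Up to the factor \<open>C\<close> this is an average of translates of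
  the signed sum, and Jensen's inequality for the exponential applies. The choice of \<open>\<epsilon>\<close> is free, which
  allows averaging over all signs afterwards.\<close>

lemma sum_exp_le_signed:
  fixes t C :: real
  assumes \<epsilon>: "\<And>\<gamma>. \<gamma> \<in> F \<Longrightarrow> \<epsilon> \<gamma> \<in> {-1, 1 :: real}"
    and C: "(\<Sum>y\<in>T. cmod (\<nu> y)) \<le> C"
    and \<nu>: "\<And>\<gamma>. \<gamma> \<in> F \<Longrightarrow> (\<Sum>y\<in>T. \<nu> y * cnj (y \<gamma>)) = of_real (\<epsilon> \<gamma>)"
  shows "(\<Sum>x\<in>T. exp (t * (\<Sum>\<gamma>\<in>F. Re (x \<gamma>)))) \<le>
           (\<Sum>x\<in>T. exp (C * \<bar>t\<bar> * cmod (\<Sum>\<gamma>\<in>F. of_real (\<epsilon> \<gamma>) * x \<gamma>)))"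
proof -
  define g where "g x = (\<Sum>\<gamma>\<in>F. of_real (\<epsilon> \<gamma>) * x \<gamma>)" for x :: "'a \<Rightarrow> complex"
  define W where "W = (\<Sum>y\<in>T. cmod (\<nu> y))"
  have W0: "0 \<le> W" unfolding W_def by (intro sum_nonneg) simp
  have "0 \<le> C" using W0 C W_def by linarith
  have bound: "t * (\<Sum>\<gamma>\<in>F. Re (x \<gamma>)) \<le> (\<Sum>y\<in>T. cmod (\<nu> y) * (\<bar>t\<bar> * cmod (g (\<lambda>\<gamma>. x \<gamma> * cnj (y \<gamma>)))))" for x
  proof -
    have sq: "of_real (\<epsilon> \<gamma>) * of_real (\<epsilon> \<gamma>) = (1::complex)" if "\<gamma> \<in> F" for \<gamma>
      using \<epsilon>[OF that] by auto
    \<comment> \<open>The convolution identity: insert \<open>1 = \<epsilon> \<gamma> * (\<Sum>y\<in>T. \<nu> y * cnj (y \<gamma>))\<close>.\<close>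
    have "(\<Sum>\<gamma>\<in>F. x \<gamma>) = (\<Sum>\<gamma>\<in>F. of_real (\<epsilon> \<gamma>) * x \<gamma> * (\<Sum>y\<in>T. \<nu> y * cnj (y \<gamma>)))"
    proof (intro sum.cong refl)
      fix \<gamma> assume "\<gamma> \<in> F"
      then show "x \<gamma> = of_real (\<epsilon> \<gamma>) * x \<gamma> * (\<Sum>y\<in>T. \<nu> y * cnj (y \<gamma>))"
        using sq[of \<gamma>] \<nu>[of \<gamma>] by (simp only: mult.commute[of _ "x \<gamma>"] mult.assoc mult_1_right)
    qed
    also have "\<dots> = (\<Sum>y\<in>T. \<nu> y * g (\<lambda>\<gamma>. x \<gamma> * cnj (y \<gamma>)))"
      unfolding g_def sum_distrib_left by (subst sum.swap) (simp add: mult_ac)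
    finally have eq: "(\<Sum>\<gamma>\<in>F. x \<gamma>) = (\<Sum>y\<in>T. \<nu> y * g (\<lambda>\<gamma>. x \<gamma> * cnj (y \<gamma>)))" .
    have "t * (\<Sum>\<gamma>\<in>F. Re (x \<gamma>)) = t * Re (\<Sum>\<gamma>\<in>F. x \<gamma>)"
      by simp
    also have "\<dots> \<le> \<bar>t\<bar> * cmod (\<Sum>\<gamma>\<in>F. x \<gamma>)"
      using abs_Re_le_cmod[of "\<Sum>\<gamma>\<in>F. x \<gamma>"] abs_ge_self[of "t * Re (\<Sum>\<gamma>\<in>F. x \<gamma>)"]
      unfolding abs_mult by (simp only: Re_sum) (meson abs_ge_zero mult_left_mono order_trans)
    also have "\<dots> \<le> \<bar>t\<bar> * (\<Sum>y\<in>T. cmod (\<nu> y * g (\<lambda>\<gamma>. x \<gamma> * cnj (y \<gamma>))))"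
      unfolding eq by (intro mult_left_mono norm_sum) simp
    finally show ?thesis
      by (simp add: norm_mult sum_distrib_left mult_ac)
  qed
  have "(\<Sum>x\<in>T. exp (t * (\<Sum>\<gamma>\<in>F. Re (x \<gamma>)))) \<le> (\<Sum>x\<in>T. exp (C * \<bar>t\<bar> * cmod (g x)))"
  proof (cases "W = 0")
    case True
    then have "cmod (\<nu> y) = 0" if "y \<in> T" for y
      using that finite_T unfolding W_def by (subst (asm) sum_nonneg_eq_0_iff) auto
    then have "t * (\<Sum>\<gamma>\<in>F. Re (x \<gamma>)) \<le> 0" for x
      using bound[of x] by simp
    then have "exp (t * (\<Sum>\<gamma>\<in>F. Re (x \<gamma>))) \<le> 1" for x
      by simp
    moreover have "1 \<le> exp (C * \<bar>t\<bar> * cmod (g x))" for x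
      using \<open>0 \<le> C\<close> by simp
    ultimately show ?thesis
      by (intro sum_mono) (meson order_trans)
  next
    case False
    with W0 have "0 < W" by simp
    have "exp (t * (\<Sum>\<gamma>\<in>F. Re (x \<gamma>))) \<le>
            (\<Sum>y\<in>T. cmod (\<nu> y) / W * exp (C * \<bar>t\<bar> * cmod (g (\<lambda>\<gamma>. x \<gamma> * cnj (y \<gamma>)))))" for x
    proof -
      define h where "h y = \<bar>t\<bar> * cmod (g (\<lambda>\<gamma>. x \<gamma> * cnj (y \<gamma>)))" for y
      have "exp (t * (\<Sum>\<gamma>\<in>F. Re (x \<gamma>))) \<le> exp (\<Sum>y\<in>T. (cmod (\<nu> y) / W) *\<^sub>R (W * h y))"
        using bound[of x] \<open>0 < W\<close> by (simp add: h_def)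
      also have "\<dots> \<le> (\<Sum>y\<in>T. cmod (\<nu> y) / W * exp (W * h y))"
        using finite_T nonempty_T \<open>0 < W\<close>
        by (intro convex_on_sum[OF _ _ exp_convex]) (auto simp flip: sum_divide_distrib W_def)
      also have "\<dots> \<le> (\<Sum>y\<in>T. cmod (\<nu> y) / W * exp (C * h y))"
        using \<open>0 < W\<close> C
        by (intro sum_mono mult_left_mono) (auto simp: h_def W_def intro!: mult_right_mono)
      finally show ?thesis
        by (simp add: h_def mult.assoc)
    qed
    then have "(\<Sum>x\<in>T. exp (t * (\<Sum>\<gamma>\<in>F. Re (x \<gamma>)))) \<le>
        (\<Sum>x\<in>T. \<Sum>y\<in>T. cmod (\<nu> y) / W * exp (C * \<bar>t\<bar> * cmod (g (\<lambda>\<gamma>. x \<gamma> * cnj (y \<gamma>)))))"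
      by (intro sum_mono)
    also have "\<dots> = (\<Sum>y\<in>T. cmod (\<nu> y) / W *
                      (\<Sum>x\<in>T. exp (C * \<bar>t\<bar> * cmod (g (\<lambda>\<gamma>. x \<gamma> * cnj (y \<gamma>))))))"
      by (subst sum.swap) (simp add: sum_distrib_left)
    also have "\<dots> = (\<Sum>y\<in>T. cmod (\<nu> y) / W * (\<Sum>x\<in>T. exp (C * \<bar>t\<bar> * cmod (g x))))"
      by (intro sum.cong refl, subst sum_translate_cnj[where g = "\<lambda>x. exp (C * \<bar>t\<bar> * cmod (g x))"]) auto
    also have "\<dots> = (\<Sum>x\<in>T. exp (C * \<bar>t\<bar> * cmod (g x)))"
      using \<open>0 < W\<close> by (simp flip: sum_distrib_right sum_divide_distrib W_def)
    finally show ?thesis .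
  qed
  then show ?thesis by (simp add: g_def)
qed

text \<open>Rudin's theorem in exponential form: averaging the previous bound over all signs makes it subgaussian
  in \<open>t\<close>, with variance proportional to the size of \<open>F\<close>.\<close>

lemma exp_moment:
  fixes t C :: real
  assumes "finite F" "interpolates_signs F C"
  shows "(\<Sum>x\<in>T. exp (t * (\<Sum>\<gamma>\<in>F. Re (x \<gamma>)))) \<le> card T * (2 * exp (4 * C\<^sup>2 * t\<^sup>2 * card F))"
proof -
  define S where "S = F \<rightarrow>\<^sub>E {-1, 1 :: real}"
  define a where "a = C * \<bar>t\<bar>"
  have finS: "finite S" and cardS: "card S = 2 ^ card F"
    using assms(1) by (simp_all add: S_def finite_PiE card_PiE card_insert_if numeral_2_eq_2)
  have "0 \<le> C"
  proof -
    obtain \<nu> where "(\<Sum>y\<in>T. cmod (\<nu> y)) \<le> C"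
      using assms(2)[unfolded interpolates_signs_def, rule_format, of "\<lambda>_. 1"] by auto
    then show ?thesis
      by (meson norm_ge_zero order_trans sum_nonneg)
  qed
  then have "0 \<le> a" by (simp add: a_def)
  have le: "(\<Sum>x\<in>T. exp (t * (\<Sum>\<gamma>\<in>F. Re (x \<gamma>)))) \<le>
          (\<Sum>x\<in>T. exp (a * cmod (\<Sum>\<gamma>\<in>F. of_real (\<epsilon> \<gamma>) * x \<gamma>)))" if "\<epsilon> \<in> S" for \<epsilon>
  proof -
    have \<epsilon>: "\<epsilon> \<gamma> \<in> {-1, 1}" if "\<gamma> \<in> F" for \<gamma>
      using \<open>\<epsilon> \<in> S\<close> that unfolding S_def by (rule PiE_mem)
    then have "\<exists>\<nu>. (\<Sum>y\<in>T. cmod (\<nu> y)) \<le> C \<and>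
             (\<forall>\<gamma>\<in>F. (\<Sum>y\<in>T. \<nu> y * cnj (y \<gamma>)) = of_real (\<epsilon> \<gamma>))"
      using assms(2) unfolding interpolates_signs_def by blast
    then obtain \<nu> where "(\<Sum>y\<in>T. cmod (\<nu> y)) \<le> C"
        "\<And>\<gamma>. \<gamma> \<in> F \<Longrightarrow> (\<Sum>y\<in>T. \<nu> y * cnj (y \<gamma>)) = of_real (\<epsilon> \<gamma>)"
      by blast
    with \<epsilon> show ?thesis
      unfolding a_def by (intro sum_exp_le_signed)
  qed
  have "2 ^ card F * (\<Sum>x\<in>T. exp (t * (\<Sum>\<gamma>\<in>F. Re (x \<gamma>)))) =
          (\<Sum>\<epsilon>\<in>S. \<Sum>x\<in>T. exp (t * (\<Sum>\<gamma>\<in>F. Re (x \<gamma>))))"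
    by (simp add: cardS)
  also have "\<dots> \<le> (\<Sum>\<epsilon>\<in>S. \<Sum>x\<in>T. exp (a * cmod (\<Sum>\<gamma>\<in>F. of_real (\<epsilon> \<gamma>) * x \<gamma>)))"
    by (intro sum_mono le)
  also have "\<dots> = (\<Sum>x\<in>T. \<Sum>\<epsilon>\<in>S. exp (a * cmod (\<Sum>\<gamma>\<in>F. of_real (\<epsilon> \<gamma>) * x \<gamma>)))"
    by (rule sum.swap)
  also have "\<dots> \<le> (\<Sum>x\<in>T. 2 ^ card F * (2 * exp (4 * C\<^sup>2 * t\<^sup>2 * card F)))"
  proof (intro sum_mono)
    fix x assume x: "x \<in> T"
    have unit: "\<bar>Re (x \<gamma>)\<bar> \<le> 1" "\<bar>Im (x \<gamma>)\<bar> \<le> 1" for \<gamma>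
      using abs_Re_le_cmod[of "x \<gamma>"] abs_Im_le_cmod[of "x \<gamma>"] norm_T[OF x, of \<gamma>] by auto
    have a2: "(2 * a)\<^sup>2 = 4 * C\<^sup>2 * t\<^sup>2" "(-2 * a)\<^sup>2 = 4 * C\<^sup>2 * t\<^sup>2"
      by (simp_all add: a_def power_mult_distrib)
    have signs: "(\<Sum>\<epsilon>\<in>S. exp (s * (\<Sum>\<gamma>\<in>F. \<epsilon> \<gamma> * Re (x \<gamma>)))) \<le> 2 ^ card F * exp (s\<^sup>2 * card F)"
        "(\<Sum>\<epsilon>\<in>S. exp (s * (\<Sum>\<gamma>\<in>F. \<epsilon> \<gamma> * Im (x \<gamma>)))) \<le> 2 ^ card F * exp (s\<^sup>2 * card F)" for s
      unfolding S_def by (intro sum_signs_exp_le assms(1) unit)+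
    have parts: "Re (\<Sum>\<gamma>\<in>F. of_real (\<epsilon> \<gamma>) * x \<gamma>) = (\<Sum>\<gamma>\<in>F. \<epsilon> \<gamma> * Re (x \<gamma>))"
        "Im (\<Sum>\<gamma>\<in>F. of_real (\<epsilon> \<gamma>) * x \<gamma>) = (\<Sum>\<gamma>\<in>F. \<epsilon> \<gamma> * Im (x \<gamma>))" for \<epsilon>
      by simp_all
    have "(\<Sum>\<epsilon>\<in>S. exp (a * cmod (\<Sum>\<gamma>\<in>F. of_real (\<epsilon> \<gamma>) * x \<gamma>))) \<le>
      (\<Sum>\<epsilon>\<in>S. (exp (2 * a * (\<Sum>\<gamma>\<in>F. \<epsilon> \<gamma> * Re (x \<gamma>))) + exp (-2 * a * (\<Sum>\<gamma>\<in>F. \<epsilon> \<gamma> * Re (x \<gamma>)))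
         + exp (2 * a * (\<Sum>\<gamma>\<in>F. \<epsilon> \<gamma> * Im (x \<gamma>))) + exp (-2 * a * (\<Sum>\<gamma>\<in>F. \<epsilon> \<gamma> * Im (x \<gamma>)))) / 2)"
      unfolding parts[symmetric] by (intro sum_mono exp_cmod_le \<open>0 \<le> a\<close>)
    also have "\<dots> \<le> 2 ^ card F * (2 * exp (4 * C\<^sup>2 * t\<^sup>2 * card F))"
      using signs(1)[of "2 * a"] signs(1)[of "-2 * a"] signs(2)[of "2 * a"] signs(2)[of "-2 * a"]
      unfolding a2 by (simp add: sum.distrib flip: sum_divide_distrib)
    finally show "(\<Sum>\<epsilon>\<in>S. exp (a * cmod (\<Sum>\<gamma>\<in>F. of_real (\<epsilon> \<gamma>) * x \<gamma>)))
      \<le> 2 ^ card F * (2 * exp (4 * C\<^sup>2 * t\<^sup>2 * card F))" .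
  qed
  also have "\<dots> = 2 ^ card F * (card T * (2 * exp (4 * C\<^sup>2 * t\<^sup>2 * card F)))"
    by simp
  finally show ?thesis
    by simp
qed

text \<open>Convexity of the exponential reduces the sum of the first \<open>m\<close> powers to a single power, and a power
  map that permutes \<open>T\<close> does not change the average.\<close>

lemma exp_moment_powers:
  fixes t C :: real and m :: nat
  assumes "finite F" "interpolates_signs F C" "1 \<le> m"
    and bij: "\<And>j. 1 \<le> j \<Longrightarrow> j \<le> m \<Longrightarrow> bij_betw (\<lambda>x \<gamma>. x \<gamma> ^ j) T T"
  shows "(\<Sum>x\<in>T. exp (t * (\<Sum>\<gamma>\<in>F. \<Sum>j=1..m. 2 * Re (x \<gamma> ^ j)))) \<le>
           card T * (2 * exp (16 * (real m)\<^sup>2 * C\<^sup>2 * t\<^sup>2 * card F))"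
proof -
  define f where "f x = exp (2 * m * t * (\<Sum>\<gamma>\<in>F. Re (x \<gamma>)))" for x :: "'a \<Rightarrow> complex"
  have "(\<Sum>x\<in>T. exp (t * (\<Sum>\<gamma>\<in>F. \<Sum>j=1..m. 2 * Re (x \<gamma> ^ j)))) \<le>
          (\<Sum>x\<in>T. \<Sum>j=1..m. 1 / m * f (\<lambda>\<gamma>. x \<gamma> ^ j))"
  proof (intro sum_mono)
    fix x
    have "t * (\<Sum>\<gamma>\<in>F. \<Sum>j=1..m. 2 * Re (x \<gamma> ^ j)) =
            (\<Sum>j=1..m. (1 / real m) *\<^sub>R (2 * m * t * (\<Sum>\<gamma>\<in>F. Re (x \<gamma> ^ j))))"
      using assms(3) by (subst sum.swap) (simp add: sum_distrib_left mult_ac)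
    also have "exp \<dots> \<le> (\<Sum>j=1..m. 1 / m * f (\<lambda>\<gamma>. x \<gamma> ^ j))"
      unfolding f_def using assms(3) by (intro convex_on_sum[OF _ _ exp_convex]) auto
    finally show "exp (t * (\<Sum>\<gamma>\<in>F. \<Sum>j=1..m. 2 * Re (x \<gamma> ^ j))) \<le> (\<Sum>j=1..m. 1 / m * f (\<lambda>\<gamma>. x \<gamma> ^ j))" .
  qed
  also have "\<dots> = (\<Sum>j=1..m. 1 / m * (\<Sum>x\<in>T. f (\<lambda>\<gamma>. x \<gamma> ^ j)))"
    by (subst sum.swap) (simp add: sum_distrib_left)
  also have "\<dots> = (\<Sum>j=1..m. 1 / m * (\<Sum>x\<in>T. f x))"
    using sum.reindex_bij_betw[OF bij, of _ f] by (intro sum.cong refl) auto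
  also have "\<dots> = (\<Sum>x\<in>T. f x)"
    using assms(3) by simp
  also have "\<dots> \<le> card T * (2 * exp (4 * C\<^sup>2 * (2 * m * t)\<^sup>2 * card F))"
    unfolding f_def by (rule exp_moment[OF assms(1,2)])
  also have "4 * C\<^sup>2 * (2 * m * t)\<^sup>2 * card F = 16 * (real m)\<^sup>2 * C\<^sup>2 * t\<^sup>2 * card F"
    by (simp add: power_mult_distrib)
  finally show ?thesis .
qed

end

section \<open>Independent subsets of positive density\<close>

lemma sum_bernoulli_weights:
  fixes \<delta> :: real
  assumes "finite F" "S \<subseteq> F"
  shows "(\<Sum>A\<in>{A\<in>Pow F. S \<subseteq> A}. \<delta> ^ card A * (1 - \<delta>) ^ card (F - A)) = \<delta> ^ card S"
proof -
  have fin: "finite S" using assms finite_subset by auto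
  have "bij_betw (\<lambda>B. S \<union> B) (Pow (F - S)) {A\<in>Pow F. S \<subseteq> A}"
    by (rule bij_betwI[where g = "\<lambda>A. A - S"]) (use assms in auto)
  then have "(\<Sum>A\<in>{A\<in>Pow F. S \<subseteq> A}. \<delta> ^ card A * (1 - \<delta>) ^ card (F - A)) =
          (\<Sum>B\<in>Pow (F - S). \<delta> ^ card (S \<union> B) * (1 - \<delta>) ^ card (F - (S \<union> B)))"
    by (rule sum.reindex_bij_betw[symmetric])
  also have "\<dots> = (\<Sum>B\<in>Pow (F - S). \<delta> ^ card S * (\<delta> ^ card B * (1 - \<delta>) ^ card (F - S - B)))"
  proof (intro sum.cong refl)
    fix B assume B: "B \<in> Pow (F - S)"
    then have "card (S \<union> B) = card S + card B"
      using assms fin by (intro card_Un_disjoint) (auto intro: finite_subset)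
    moreover have "F - (S \<union> B) = F - S - B" by auto
    ultimately show "\<delta> ^ card (S \<union> B) * (1 - \<delta>) ^ card (F - (S \<union> B)) =
        \<delta> ^ card S * (\<delta> ^ card B * (1 - \<delta>) ^ card (F - S - B))"
      by (simp add: power_add)
  qed
  also have "\<dots> = \<delta> ^ card S * (\<Prod>\<gamma>\<in>F - S. \<delta> + (1 - \<delta>))"
    using assms by (subst prod_add) (simp_all add: sum_distrib_left)
  finally show ?thesis by simp
qed

text \<open>The probabilistic method. Choose \<open>A\<close> at random, each element of \<open>F\<close> independently with probability
  \<open>\<delta>\<close>. The expectation of \<open>card A - card F * card {r \<in> R. supp r \<subseteq> A}\<close> is at least
  \<open>3 / 4 * \<delta> * card F\<close>. A set that attains this value contains no forbidden support, since a single one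
  already makes the difference nonpositive.\<close>

lemma large_subset_avoiding:
  fixes \<delta> :: real and supp :: "'r \<Rightarrow> 'a set"
  assumes "finite F" "F \<noteq> {}" "finite R" and \<delta>: "0 < \<delta>" "\<delta> \<le> 1"
    and supp: "\<And>r. r \<in> R \<Longrightarrow> supp r \<subseteq> F"
    and small: "(\<Sum>r\<in>R. \<delta> ^ card (supp r)) \<le> \<delta> / 4"
  shows "\<exists>A\<subseteq>F. 3 / 4 * \<delta> * card F \<le> card A \<and> (\<forall>r\<in>R. \<not> supp r \<subseteq> A)"
proof -
  define w where "w A = \<delta> ^ card A * (1 - \<delta>) ^ card (F - A)" for A
  define N where "N = real (card F)"
  define bad where "bad A = {r\<in>R. supp r \<subseteq> A}" for A
  have w0: "0 \<le> w A" for A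
    using \<delta> by (simp add: w_def)
  have w: "(\<Sum>A\<in>Pow F. w A * of_bool (S \<subseteq> A)) = \<delta> ^ card S" if "S \<subseteq> F" for S
  proof -
    have "(\<Sum>A\<in>Pow F. w A * of_bool (S \<subseteq> A)) = (\<Sum>A\<in>Pow F. if S \<subseteq> A then w A else 0)"
      by (intro sum.cong) auto
    also have "\<dots> = (\<Sum>A\<in>{A\<in>Pow F. S \<subseteq> A}. w A)"
      using assms(1) by (subst sum.inter_filter) auto
    finally show ?thesis
      unfolding w_def sum_bernoulli_weights[OF assms(1) that] .
  qed
  have total: "(\<Sum>A\<in>Pow F. w A) = 1"
    using w[of "{}"] by simp
  have "(\<Sum>A\<in>Pow F. w A * card A) = (\<Sum>A\<in>Pow F. \<Sum>\<gamma>\<in>F. w A * of_bool ({\<gamma>} \<subseteq> A))"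
  proof (intro sum.cong refl)
    fix A assume "A \<in> Pow F"
    then have "card A = (\<Sum>\<gamma>\<in>F. of_bool ({\<gamma>} \<subseteq> A))"
      using assms(1) by (simp add: of_bool_def Int_absorb1 Int_absorb2 flip: sum.inter_filter Int_def Collect_conj_eq)
    then show "w A * card A = (\<Sum>\<gamma>\<in>F. w A * of_bool ({\<gamma>} \<subseteq> A))"
      by (simp flip: sum_distrib_left)
  qed
  also have "\<dots> = (\<Sum>\<gamma>\<in>F. \<delta> ^ card {\<gamma>})"
    by (subst sum.swap) (intro sum.cong refl w, simp)
  also have "\<dots> = \<delta> * N"
    by (simp add: N_def)
  finally have size: "(\<Sum>A\<in>Pow F. w A * card A) = \<delta> * N" .
  have "(\<Sum>A\<in>Pow F. w A * card (bad A)) = (\<Sum>A\<in>Pow F. \<Sum>r\<in>R. w A * of_bool (supp r \<subseteq> A))"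
  proof (intro sum.cong refl)
    fix A
    have "card (bad A) = (\<Sum>r\<in>R. of_bool (supp r \<subseteq> A))"
      using assms(3) by (simp add: bad_def of_bool_def flip: sum.inter_filter)
    then show "w A * card (bad A) = (\<Sum>r\<in>R. w A * of_bool (supp r \<subseteq> A))"
      by (simp flip: sum_distrib_left)
  qed
  also have "\<dots> = (\<Sum>r\<in>R. \<delta> ^ card (supp r))"
    by (subst sum.swap) (intro sum.cong refl w supp)
  finally have bad: "(\<Sum>A\<in>Pow F. w A * card (bad A)) \<le> \<delta> / 4"
    using small by simp
  have "\<exists>A\<in>Pow F. 3 / 4 * \<delta> * N \<le> card A - N * card (bad A)"
  proof (rule ccontr)
    assume contra: "\<not> ?thesis"
    have less: "card A - N * card (bad A) < 3 / 4 * \<delta> * N" if "A \<in> Pow F" for A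
      using that contra not_le by blast
    have "\<delta> * N - N * (\<delta> / 4) \<le> \<delta> * N - N * (\<Sum>A\<in>Pow F. w A * card (bad A))"
      using bad by (intro diff_left_mono mult_left_mono) (auto simp: N_def)
    also have "\<dots> = (\<Sum>A\<in>Pow F. w A * (card A - N * card (bad A)))"
      unfolding size[symmetric] by (simp add: right_diff_distrib sum_subtractf sum_distrib_left mult_ac)
    also have "\<dots> < (\<Sum>A\<in>Pow F. w A * (3 / 4 * \<delta> * N))"
    proof (rule sum_strict_mono_ex1)
      show "\<forall>A\<in>Pow F. w A * (card A - N * card (bad A)) \<le> w A * (3 / 4 * \<delta> * N)"
        by (intro ballI mult_left_mono w0 less_imp_le[OF less])
      have "0 < w F"
        using \<delta> by (simp add: w_def)
      then show "\<exists>A\<in>Pow F. w A * (card A - N * card (bad A)) < w A * (3 / 4 * \<delta> * N)"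
        using less[of F] by (intro bexI[of _ F] mult_strict_left_mono) auto
    qed (use assms in simp)
    also have "\<dots> = 3 / 4 * \<delta> * N"
      unfolding sum_distrib_right[symmetric] total by simp
    finally show False by simp
  qed
  then obtain A where A: "A \<subseteq> F" "3 / 4 * \<delta> * N \<le> card A - N * card (bad A)"
    by auto
  have "N > 0"
    using assms(1,2) by (simp add: N_def card_gt_0_iff)
  have "card (bad A) = 0"
  proof (rule ccontr)
    assume "card (bad A) \<noteq> 0"
    then have "N * 1 \<le> N * card (bad A)"
      using \<open>N > 0\<close> by (intro mult_left_mono) auto
    moreover have "card A \<le> N"
      using A(1) assms(1) by (simp add: N_def card_mono)
    moreover have "0 < 3 / 4 * \<delta> * N"
      using \<delta> \<open>N > 0\<close> by simp
    ultimately show False using A(2) by linarith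
  qed
  then have "3 / 4 * \<delta> * card F \<le> card A"
    using A(2) by (simp add: N_def)
  moreover have "bad A = {}"
    using \<open>card (bad A) = 0\<close> assms(3) by (simp add: bad_def)
  ultimately show ?thesis
    using A(1) by (intro exI[of _ A]) (auto simp: bad_def)
qed

context circle_valued_group
begin

definition relations :: "nat \<Rightarrow> 'a set \<Rightarrow> ('a \<Rightarrow> int) set" where
  "relations m F = {r \<in> F \<rightarrow>\<^sub>E {- int m..int m}. relation F r}"

lemma finite_relations: "finite F \<Longrightarrow> finite (relations m F)"
  by (simp add: relations_def finite_PiE)

text \<open>The product \<open>\<Prod>\<gamma>\<in>F. 1 + t * (\<Sum>j=1..m. x \<gamma> ^ j + cnj (x \<gamma>) ^ j)\<close> has mean
  \<open>\<Sum>r\<in>relations m F. t ^ card {\<gamma>\<in>F. r \<gamma> \<noteq> 0}\<close>. The restriction on \<open>t\<close> makes its factors nonnegative, so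
  that \<open>1 + s \<le> exp s\<close> may be applied to each of them.\<close>

lemma sum_relations_le:
  fixes t C :: real
  assumes "finite F" "interpolates_signs F C" "1 \<le> m"
    and bij: "\<And>j. 1 \<le> j \<Longrightarrow> j \<le> m \<Longrightarrow> bij_betw (\<lambda>x \<gamma>. x \<gamma> ^ j) T T"
    and t: "0 \<le> t" "2 * m * t \<le> 1"
  shows "(\<Sum>r\<in>relations m F. t ^ card {\<gamma>\<in>F. r \<gamma> \<noteq> 0}) \<le> 2 * exp (16 * (real m)\<^sup>2 * C\<^sup>2 * t\<^sup>2 * card F)"
proof -
  define f where "f x \<gamma> = 1 + t * (\<Sum>j=1..m. 2 * Re (x \<gamma> ^ j))" for x :: "'a \<Rightarrow> complex" and \<gamma>
  define c where "c i = (if i = 0 then 1 else t)" for i :: int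
  have expand: "complex_of_real (f x \<gamma>) = (\<Sum>i\<in>{- int m..int m}. of_real (c i) * x \<gamma> powi i)"
    if "x \<in> T" for x \<gamma>
  proof -
    have split: "{- int m..int m} = insert 0 (int ` {1..m} \<union> (\<lambda>j. - int j) ` {1..m})"
    proof (intro equalityI subsetI)
      fix i assume "i \<in> {- int m..int m}"
      then have "i = 0 \<or> i = int (nat i) \<and> nat i \<in> {1..m} \<or> i = - int (nat (-i)) \<and> nat (-i) \<in> {1..m}"
        by auto
      then show "i \<in> insert 0 (int ` {1..m} \<union> (\<lambda>j. - int j) ` {1..m})"
        by blast
    qed auto
    have inv: "inverse (x \<gamma>) = cnj (x \<gamma>)"
      using mult_cnj_T[OF that, of \<gamma>] by (metis inverse_unique)
    have "(\<Sum>i\<in>{- int m..int m}. of_real (c i) * x \<gamma> powi i) =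
            1 + ((\<Sum>i\<in>int ` {1..m}. of_real (c i) * x \<gamma> powi i) +
                 (\<Sum>i\<in>(\<lambda>j. - int j) ` {1..m}. of_real (c i) * x \<gamma> powi i))"
      unfolding split by (subst sum.insert, simp, force, subst sum.union_disjoint) (auto simp: c_def)
    also have "(\<Sum>i\<in>int ` {1..m}. of_real (c i) * x \<gamma> powi i) = (\<Sum>j=1..m. of_real t * x \<gamma> ^ j)"
      by (subst sum.reindex) (auto simp: c_def inj_on_def intro!: sum.cong)
    also have "(\<Sum>i\<in>(\<lambda>j. - int j) ` {1..m}. of_real (c i) * x \<gamma> powi i) =
                 (\<Sum>j=1..m. of_real t * cnj (x \<gamma> ^ j))"
      by (subst sum.reindex)
         (auto simp: c_def inj_on_def power_int_minus power_inverse[symmetric] inv intro!: sum.cong)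
    finally have "(\<Sum>i\<in>{- int m..int m}. of_real (c i) * x \<gamma> powi i) =
        1 + (\<Sum>j=1..m. of_real t * (x \<gamma> ^ j + cnj (x \<gamma> ^ j)))"
      by (simp only: sum.distrib distrib_left)
    then show ?thesis
      unfolding complex_add_cnj by (simp add: f_def sum_distrib_left)
  qed
  have nonneg: "0 \<le> f x \<gamma>" if "x \<in> T" for x \<gamma>
  proof -
    have "- 2 * real m = (\<Sum>j=1..m. - 2)" by simp
    also have "\<dots> \<le> (\<Sum>j=1..m. 2 * Re (x \<gamma> ^ j))"
    proof (intro sum_mono)
      fix j
      have "\<bar>Re (x \<gamma> ^ j)\<bar> \<le> 1"
        using abs_Re_le_cmod[of "x \<gamma> ^ j"] norm_T[OF that, of \<gamma>] by (simp add: norm_power)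
      then show "- 2 \<le> 2 * Re (x \<gamma> ^ j)" by linarith
    qed
    finally have "t * (- 2 * real m) \<le> t * (\<Sum>j=1..m. 2 * Re (x \<gamma> ^ j))"
      using t(1) by (rule mult_left_mono)
    with t(2) show ?thesis by (simp add: f_def algebra_simps)
  qed
  have prod_c: "(\<Prod>\<gamma>\<in>F. c (r \<gamma>)) = t ^ card {\<gamma>\<in>F. r \<gamma> \<noteq> 0}" for r
  proof -
    have "(\<Prod>\<gamma>\<in>F. c (r \<gamma>)) = (\<Prod>\<gamma>\<in>F. if r \<gamma> \<noteq> 0 then t else 1)"
      by (intro prod.cong) (auto simp: c_def)
    also have "\<dots> = (\<Prod>\<gamma>\<in>{\<gamma>\<in>F. r \<gamma> \<noteq> 0}. t)"
      using assms(1) by (subst prod.inter_filter) auto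
    finally show ?thesis by simp
  qed
  have "complex_of_real (card T * (\<Sum>r\<in>relations m F. t ^ card {\<gamma>\<in>F. r \<gamma> \<noteq> 0})) =
          of_nat (card T) * (\<Sum>r\<in>relations m F. \<Prod>\<gamma>\<in>F. of_real (c (r \<gamma>)))"
    by (simp add: prod_c flip: of_real_prod)
  also have "\<dots> = (\<Sum>x\<in>T. \<Prod>\<gamma>\<in>F. \<Sum>i\<in>{- int m..int m}. of_real (c i) * x \<gamma> powi i)"
    unfolding relations_def using assms(1) by (subst sum_prod_expansion) auto
  also have "\<dots> = complex_of_real (\<Sum>x\<in>T. \<Prod>\<gamma>\<in>F. f x \<gamma>)"
    by (simp add: expand)
  finally have "card T * (\<Sum>r\<in>relations m F. t ^ card {\<gamma>\<in>F. r \<gamma> \<noteq> 0}) = (\<Sum>x\<in>T. \<Prod>\<gamma>\<in>F. f x \<gamma>)"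
    by (simp only: of_real_eq_iff)
  also have "\<dots> \<le> (\<Sum>x\<in>T. exp (t * (\<Sum>\<gamma>\<in>F. \<Sum>j=1..m. 2 * Re (x \<gamma> ^ j))))"
  proof (intro sum_mono)
    fix x assume x: "x \<in> T"
    have "(\<Prod>\<gamma>\<in>F. f x \<gamma>) \<le> (\<Prod>\<gamma>\<in>F. exp (t * (\<Sum>j=1..m. 2 * Re (x \<gamma> ^ j))))"
      using nonneg[OF x] by (intro prod_mono conjI) (auto simp: f_def intro: exp_ge_add_one_self)
    then show "(\<Prod>\<gamma>\<in>F. f x \<gamma>) \<le> exp (t * (\<Sum>\<gamma>\<in>F. \<Sum>j=1..m. 2 * Re (x \<gamma> ^ j)))"
      using assms(1) by (simp only: exp_sum sum_distrib_left)
  qed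
  also have "\<dots> \<le> card T * (2 * exp (16 * (real m)\<^sup>2 * C\<^sup>2 * t\<^sup>2 * card F))"
    by (rule exp_moment_powers[OF assms(1-4)])
  finally show ?thesis
    using card_T_pos by simp
qed

text \<open>Remove from \<open>A\<close> the support of a relation \<open>r\<close> of maximal support. A relation \<open>s\<close> on the remaining set
  \<open>H\<close> can be glued to \<open>r\<close>, as the supports are disjoint, and maximality forces \<open>s\<close> to vanish.\<close>

lemma independent_of_small_supports:
  assumes "finite F" "A \<subseteq> F"
    and small: "\<And>r. r \<in> relations m F \<Longrightarrow> {\<gamma>\<in>F. r \<gamma> \<noteq> 0} \<subseteq> A \<Longrightarrow> card {\<gamma>\<in>F. r \<gamma> \<noteq> 0} \<le> k"
  obtains H where "H \<subseteq> A" "card A \<le> card H + k" "independent_of_degree m H"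
proof -
  define supp where "supp r = {\<gamma>\<in>F. r \<gamma> \<noteq> 0}" for r :: "'a \<Rightarrow> int"
  define P where "P = {r \<in> relations m F. supp r \<subseteq> A}"
  have "finite P"
    using finite_relations[OF assms(1)] by (simp add: P_def)
  have "(\<lambda>\<gamma>\<in>F. 0) \<in> P"
    by (auto simp: P_def relations_def relation_def supp_def)
  then have "Max ((\<lambda>r. card (supp r)) ` P) \<in> (\<lambda>r. card (supp r)) ` P"
    using \<open>finite P\<close> by (intro Max_in) auto
  then obtain r where r: "r \<in> P" "card (supp r) = Max ((\<lambda>r. card (supp r)) ` P)"
    by auto
  have max: "card (supp s) \<le> card (supp r)" if "s \<in> P" for s
    using that \<open>finite P\<close> by (simp add: r(2))
  define H where "H = A - supp r"
  have finA: "finite A" using assms finite_subset by auto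
  show thesis
  proof (rule that)
    show "H \<subseteq> A" by (auto simp: H_def)
    have "card (supp r) \<le> k"
      using r(1) small by (auto simp: P_def supp_def)
    moreover have "card H = card A - card (supp r)"
      using r(1) finA unfolding H_def by (intro card_Diff_subset) (auto simp: P_def intro: finite_subset)
    ultimately show "card A \<le> card H + k" by linarith
    show "independent_of_degree m H"
      unfolding independent_of_degree_def
    proof (intro allI impI)
      fix s assume s: "relation H s \<and> (\<forall>\<gamma>\<in>H. \<bar>s \<gamma>\<bar> \<le> int m)"
      define u where "u = (\<lambda>\<gamma>\<in>F. if \<gamma> \<in> H then s \<gamma> else r \<gamma>)"
      have rH: "r \<gamma> = 0" if "\<gamma> \<in> H" for \<gamma>
        using that assms(2) by (auto simp: H_def supp_def)
      have HF: "H \<subseteq> F" using assms(2) by (auto simp: H_def)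
      have "(\<Prod>\<gamma>\<in>F. x \<gamma> powi u \<gamma>) = (\<Prod>\<gamma>\<in>F. x \<gamma> powi r \<gamma>) * (\<Prod>\<gamma>\<in>H. x \<gamma> powi s \<gamma>)"
        for x :: "'a \<Rightarrow> complex"
      proof -
        have "(\<Prod>\<gamma>\<in>F. x \<gamma> powi u \<gamma>) =
                (\<Prod>\<gamma>\<in>F. x \<gamma> powi r \<gamma> * (if \<gamma> \<in> H then x \<gamma> powi s \<gamma> else 1))"
          by (intro prod.cong) (auto simp: u_def rH)
        also have "\<dots> = (\<Prod>\<gamma>\<in>F. x \<gamma> powi r \<gamma>) * (\<Prod>\<gamma>\<in>F. if \<gamma> \<in> H then x \<gamma> powi s \<gamma> else 1)"
          by (rule prod.distrib)
        also have "(\<Prod>\<gamma>\<in>F. if \<gamma> \<in> H then x \<gamma> powi s \<gamma> else 1) = (\<Prod>\<gamma>\<in>H. x \<gamma> powi s \<gamma>)"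
          using assms(1) HF by (simp add: prod.If_cases Int_absorb1)
        finally show ?thesis .
      qed
      then have "relation F u"
        using r(1) s by (simp add: relation_def P_def relations_def)
      moreover have "u \<in> F \<rightarrow>\<^sub>E {- int m..int m}"
        using r(1) s by (auto simp: u_def P_def relations_def PiE_iff abs_le_iff)
      moreover have "supp u \<subseteq> A"
        using r(1) by (auto simp: P_def supp_def u_def H_def split: if_splits)
      ultimately have "card (supp u) \<le> card (supp r)"
        by (intro max) (simp add: P_def relations_def)
      moreover have "supp u = supp r \<union> {\<gamma>\<in>H. s \<gamma> \<noteq> 0}"
        using HF rH by (auto simp: supp_def u_def)
      moreover have "finite (supp u)"
        using assms(1) by (simp add: supp_def)
      ultimately have "supp r = supp u"
        by (intro card_seteq) auto
      with \<open>supp u = supp r \<union> {\<gamma>\<in>H. s \<gamma> \<noteq> 0}\<close> have "{\<gamma>\<in>H. s \<gamma> \<noteq> 0} \<subseteq> supp r"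
        by blast
      then show "\<forall>\<gamma>\<in>H. s \<gamma> = 0"
        by (auto simp: H_def)
    qed
  qed
qed

end

context circle_valued_group
begin

text \<open>The relation count at \<open>t = exp 8 * \<delta>\<close> shows that the relations with at least \<open>\<delta> * card F / 4\<close> nonzero
  coefficients have total weight \<open>\<Sum>r. \<delta> ^ card (supp r) \<le> 2 * exp (- \<delta> * card F)\<close>. The factor \<open>exp 8\<close>
  gains \<open>exp (- 2 * \<delta> * card F)\<close> over these relations, while the smallness of \<open>\<delta>\<close> keeps the subgaussian
  factor below \<open>exp (\<delta> * card F)\<close>.\<close>

lemma proportional_independent_subset:
  fixes \<delta> C :: real
  assumes "finite F" "interpolates_signs F C" "1 \<le> m"
    and bij: "\<And>j. 1 \<le> j \<Longrightarrow> j \<le> m \<Longrightarrow> bij_betw (\<lambda>x \<gamma>. x \<gamma> ^ j) T T"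
    and \<delta>: "0 < \<delta>" "2 * real m * (exp 8 * \<delta>) \<le> 1" "16 * (real m)\<^sup>2 * C\<^sup>2 * exp 16 * \<delta> \<le> 1"
    and large: "8 / \<delta>\<^sup>2 \<le> card F"
  shows "\<exists>H\<subseteq>F. \<delta> / 2 * card F \<le> card H \<and> independent_of_degree m H"
proof -
  define N where "N = real (card F)"
  define t where "t = exp 8 * \<delta>"
  define supp where "supp r = {\<gamma>\<in>F. r \<gamma> \<noteq> 0}" for r :: "'a \<Rightarrow> int"
  define R where "R = {r \<in> relations m F. \<delta> * N / 4 \<le> card (supp r)}"
  have "0 < 8 / \<delta>\<^sup>2" using \<delta>(1) by simp
  with large have "0 < N" unfolding N_def by linarith
  then have "F \<noteq> {}" by (auto simp: N_def)
  have "1 * 1 \<le> 2 * real m * exp 8"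
    using assms(3) by (intro mult_mono) auto
  then have "1 * \<delta> \<le> 2 * m * exp 8 * \<delta>"
    using \<delta>(1) by (intro mult_right_mono) auto
  with \<delta>(2) have "\<delta> \<le> 1" by (simp add: mult.assoc)
  have finR: "finite R"
    using finite_relations[OF assms(1)] by (simp add: R_def)
  have "(\<Sum>r\<in>R. \<delta> ^ card (supp r)) \<le> (\<Sum>r\<in>R. exp (- 2 * \<delta> * N) * t ^ card (supp r))"
  proof (intro sum_mono)
    fix r assume "r \<in> R"
    then have "exp (- (8 * real (card (supp r)))) \<le> exp (- 2 * \<delta> * N)"
      by (simp add: R_def algebra_simps)
    moreover have "\<delta> ^ card (supp r) = exp (- (8 * real (card (supp r)))) * t ^ card (supp r)"
      by (simp add: t_def power_mult_distrib exp_minus exp_of_nat2_mult)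
    moreover have "0 \<le> t ^ card (supp r)"
      using \<delta>(1) by (simp add: t_def)
    ultimately show "\<delta> ^ card (supp r) \<le> exp (- 2 * \<delta> * N) * t ^ card (supp r)"
      by (metis mult_right_mono)
  qed
  also have "\<dots> \<le> exp (- 2 * \<delta> * N) * (\<Sum>r\<in>relations m F. t ^ card (supp r))"
    unfolding sum_distrib_left[symmetric] using \<delta>(1) finite_relations[OF assms(1)]
    by (intro mult_left_mono sum_mono2) (auto simp: R_def t_def)
  also have "\<dots> \<le> exp (- 2 * \<delta> * N) * (2 * exp (16 * (real m)\<^sup>2 * C\<^sup>2 * t\<^sup>2 * N))"
    unfolding supp_def N_def using \<delta>
    by (intro mult_left_mono sum_relations_le[OF assms(1-3) bij]) (auto simp: t_def)
  also have "\<dots> \<le> exp (- 2 * \<delta> * N) * (2 * exp (\<delta> * N))"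
  proof -
    have "t\<^sup>2 = exp 16 * \<delta>\<^sup>2"
      by (simp add: t_def power_mult_distrib flip: exp_double)
    then have "16 * (real m)\<^sup>2 * C\<^sup>2 * t\<^sup>2 * N = (16 * (real m)\<^sup>2 * C\<^sup>2 * exp 16 * \<delta>) * (\<delta> * N)"
      by (simp add: power2_eq_square)
    also have "\<dots> \<le> 1 * (\<delta> * N)"
      using \<delta> \<open>0 < N\<close> by (intro mult_right_mono) auto
    finally show ?thesis by simp
  qed
  also have "\<dots> = 2 / exp (\<delta> * N)"
    by (simp add: exp_minus divide_simps mult.assoc exp_double power2_eq_square)
  also have "\<dots> \<le> 2 / (\<delta> * N)"
  proof -
    have "\<delta> * N \<le> exp (\<delta> * N)"
      using exp_ge_add_one_self[of "\<delta> * N"] by linarith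
    then show ?thesis
      using \<delta>(1) \<open>0 < N\<close> by (intro divide_left_mono) auto
  qed
  also have "\<dots> \<le> \<delta> / 4"
    using large \<delta>(1) \<open>0 < N\<close> by (simp add: N_def divide_simps power2_eq_square mult_ac)
  finally have "(\<Sum>r\<in>R. \<delta> ^ card (supp r)) \<le> \<delta> / 4" .
  then have "\<exists>A\<subseteq>F. 3 / 4 * \<delta> * card F \<le> card A \<and> (\<forall>r\<in>R. \<not> supp r \<subseteq> A)"
    using assms(1) \<open>F \<noteq> {}\<close> finR \<delta>(1) \<open>\<delta> \<le> 1\<close>
    by (intro large_subset_avoiding) (auto simp: supp_def)
  then obtain A where A: "A \<subseteq> F" "3 / 4 * \<delta> * card F \<le> card A" "\<And>r. r \<in> R \<Longrightarrow> \<not> supp r \<subseteq> A"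
    by blast
  define k where "k = nat \<lfloor>\<delta> * N / 4\<rfloor>"
  have "card (supp r) \<le> k" if "r \<in> relations m F" "supp r \<subseteq> A" for r
    using A(3)[of r] that by (force simp: R_def k_def le_nat_floor)
  then obtain H where H: "H \<subseteq> A" "card A \<le> card H + k" "independent_of_degree m H"
    using independent_of_small_supports[OF assms(1) A(1), of m k] unfolding supp_def by blast
  have "real k \<le> \<delta> * N / 4"
    unfolding k_def using \<delta>(1) \<open>0 < N\<close> by (intro of_nat_floor) simp
  with A(2) H(2) have "\<delta> / 2 * card F \<le> card H"
    unfolding N_def by linarith
  with H A(1) show ?thesis
    by (intro exI[of _ H]) auto
qed

end

section \<open>Riesz products\<close>

lemma midpoint_of_unimodular:
  assumes "cmod z \<le> 1"
  obtains u v where "cmod u = 1" "cmod v = 1" "z = (u + v) / 2"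
proof -
  define s where "s = (if z = 0 then 1 else sgn z)"
  define q where "q = sqrt (1 - (cmod z)\<^sup>2)"
  have s: "cmod s = 1" "z = s * of_real (cmod z)"
    by (cases "z = 0"; simp add: s_def norm_sgn; simp add: sgn_eq)+
  have "(cmod z)\<^sup>2 \<le> 1"
    using assms by (simp add: abs_square_le_1)
  then have "cmod (Complex (cmod z) q) = 1" "cmod (Complex (cmod z) (- q)) = 1"
    by (simp_all add: complex_norm q_def)
  then have "cmod (s * Complex (cmod z) q) = 1" "cmod (s * Complex (cmod z) (- q)) = 1"
    by (simp_all add: norm_mult s(1))
  moreover have "z = (s * Complex (cmod z) q + s * Complex (cmod z) (- q)) / 2"
  proof -
    have "Complex (cmod z) q + Complex (cmod z) (- q) = 2 * of_real (cmod z)"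
      by (simp add: complex_eq_iff)
    then have "s * Complex (cmod z) q + s * Complex (cmod z) (- q) = 2 * (s * of_real (cmod z))"
      by (simp flip: distrib_left)
    then show ?thesis
      using s(2) by simp
  qed
  ultimately show thesis using that by blast
qed

text \<open>The Fejer kernel as a square, which makes it visibly nonnegative and gives its Fourier expansion as
  a double sum without collecting equal exponents.\<close>

definition fejer :: "nat \<Rightarrow> complex \<Rightarrow> real" where
  "fejer n z = (cmod (\<Sum>j\<le>n. z ^ j))\<^sup>2 / (n + 1)"

lemma fejer_nonneg: "0 \<le> fejer n z"
  by (simp add: fejer_def)

lemma fejer_expand:
  assumes "cmod z = 1"
  shows "complex_of_real (fejer n z) =
    (\<Sum>(j, k)\<in>{..n} \<times> {..n}. z powi (int j - int k) / (n + 1))"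
proof -
  have nz: "z \<noteq> 0" using assms by auto
  have inv: "cnj z = inverse z"
    using assms complex_norm_square[of z] by (metis inverse_unique of_real_1 one_power2)
  have *: "(\<Sum>j\<le>n. z ^ j) * cnj (\<Sum>k\<le>n. z ^ k) = (\<Sum>(j, k)\<in>{..n} \<times> {..n}. z powi (int j - int k))"
    using nz by (simp add: sum_product sum.cartesian_product inv power_int_diff field_simps)
  have "complex_of_real (fejer n z) = (\<Sum>j\<le>n. z ^ j) * cnj (\<Sum>k\<le>n. z ^ k) / (n + 1)"
    by (simp only: fejer_def of_real_divide complex_norm_square of_real_of_nat_eq)
  also have "\<dots> = (\<Sum>(j, k)\<in>{..n} \<times> {..n}. z powi (int j - int k) / (n + 1))"
    unfolding * by (simp add: sum_divide_distrib case_prod_unfold)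
  finally show ?thesis .
qed

context circle_valued_group
begin

text \<open>Independence of degree \<open>n\<close> gives the product of Fejer kernels mean 1. Its Fourier coefficient at an
  element \<open>\<beta>\<close> of \<open>H\<close> is the mean after multiplication by \<open>cnj (y \<beta>)\<close>, which raises the degree to
  \<open>n + 1\<close>. At \<open>\<beta>\<close> only the \<open>n\<close> pairs \<open>(j, k)\<close> with \<open>j = k + 1\<close> then contribute, each of them
  \<open>u \<beta> / (n + 1)\<close>.\<close>

lemma riesz_product:
  assumes "independent_of_degree (Suc n) H" "finite H"
    and u: "\<And>\<gamma>. \<gamma> \<in> H \<Longrightarrow> cmod (u \<gamma>) = 1"
  shows "\<exists>w. (\<Sum>y\<in>T. cmod (w y)) = 1 \<and>
    (\<forall>\<gamma>\<in>H. (\<Sum>y\<in>T. w y * cnj (y \<gamma>)) = of_real (real n / (real n + 1)) * u \<gamma>)"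
proof -
  define K where "K y = (\<Prod>\<gamma>\<in>H. fejer n (y \<gamma> * u \<gamma>))" for y
  define I where "I = {..n} \<times> {..n}"
  define c where "c \<gamma> i = u \<gamma> powi (int (fst i) - int (snd i)) / (n + 1)" for \<gamma> i
  have finI: "finite I" by (simp add: I_def)
  have factor: "complex_of_real (fejer n (y \<gamma> * u \<gamma>)) =
      (\<Sum>i\<in>I. c \<gamma> i * y \<gamma> powi (int (fst i) - int (snd i)))" if "y \<in> T" "\<gamma> \<in> H" for y \<gamma>
    using that u norm_T
    by (subst fejer_expand)
       (auto simp: norm_mult I_def c_def power_int_mult_distrib case_prod_unfold mult_ac intro!: sum.cong)
  have diagonal: "(\<Sum>i\<in>{i\<in>I. int (fst i) - int (snd i) = 0}. c \<gamma> i) = 1" for \<gamma>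
  proof -
    have "{i\<in>I. int (fst i) - int (snd i) = 0} = (\<lambda>j. (j, j)) ` {..n}"
      by (auto simp: I_def)
    moreover have "1 + complex_of_nat n \<noteq> 0"
      by (metis of_nat_Suc of_nat_neq_0)
    ultimately show ?thesis
      by (simp add: sum.reindex inj_on_def c_def)
  qed
  have subdiagonal: "(\<Sum>i\<in>{i\<in>I. int (fst i) - int (snd i) - 1 = 0}. c \<gamma> i) = real n / (real n + 1) * u \<gamma>" for \<gamma>
  proof -
    have "{i\<in>I. int (fst i) - int (snd i) - 1 = 0} = (\<lambda>k. (Suc k, k)) ` {..<n}"
      by (auto simp: I_def image_iff)
    then have "(\<Sum>i\<in>{i\<in>I. int (fst i) - int (snd i) - 1 = 0}. c \<gamma> i) = (\<Sum>k<n. u \<gamma> / (n + 1))"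
      by (simp add: sum.reindex inj_on_def c_def)
    then show ?thesis by simp
  qed
  have "of_real (\<Sum>y\<in>T. K y) = (\<Sum>y\<in>T. \<Prod>\<gamma>\<in>H. \<Sum>i\<in>I. c \<gamma> i * y \<gamma> powi (int (fst i) - int (snd i)))"
    by (simp add: K_def factor)
  also have "\<dots> = of_nat (card T) *
      (\<Prod>\<gamma>\<in>H. \<Sum>i\<in>{i\<in>I. int (fst i) - int (snd i) = 0}. c \<gamma> i)"
    by (rule independent_sum_prod[OF assms(1,2) finI]) (auto simp: I_def)
  also have "\<dots> = of_nat (card T)"
    unfolding diagonal by simp
  finally have total: "(\<Sum>y\<in>T. K y) = card T"
    by (metis of_real_eq_iff of_real_of_nat_eq)
  show ?thesis
  proof (intro exI conjI ballI)
    have "0 \<le> K y" for y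
      by (simp add: K_def prod_nonneg fejer_nonneg)
    then show "(\<Sum>y\<in>T. cmod (of_real (K y / card T))) = 1"
      using card_T_pos total by (simp add: norm_divide flip: sum_divide_distrib)
    fix \<beta> assume \<beta>: "\<beta> \<in> H"
    define e where "e \<gamma> i = int (fst i) - int (snd i) - (if \<gamma> = \<beta> then 1 else 0)" for \<gamma> and i :: "nat \<times> nat"
    have "of_real (K y) * cnj (y \<beta>) = (\<Prod>\<gamma>\<in>H. \<Sum>i\<in>I. c \<gamma> i * y \<gamma> powi e \<gamma> i)" if "y \<in> T" for y
    proof -
      have nz: "y \<gamma> \<noteq> 0" for \<gamma> using that by (rule nonzero_T)
      have inv: "cnj (y \<beta>) = inverse (y \<beta>)"
        using mult_cnj_T[OF that, of \<beta>] by (metis inverse_unique)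
      have "cnj (y \<beta>) = (\<Prod>\<gamma>\<in>H. if \<gamma> = \<beta> then cnj (y \<beta>) else 1)"
        using \<beta> assms(2) by simp
      then have "of_real (K y) * cnj (y \<beta>) =
          (\<Prod>\<gamma>\<in>H. of_real (fejer n (y \<gamma> * u \<gamma>)) * (if \<gamma> = \<beta> then cnj (y \<beta>) else 1))"
        by (simp only: K_def of_real_prod prod.distrib)
      also have "\<dots> = (\<Prod>\<gamma>\<in>H. \<Sum>i\<in>I. c \<gamma> i * y \<gamma> powi e \<gamma> i)"
        using that nz
        by (intro prod.cong refl)
           (auto simp: factor e_def inv sum_distrib_right power_int_diff divide_inverse mult.assoc)
      finally show ?thesis .
    qed
    then have "(\<Sum>y\<in>T. of_real (K y / card T) * cnj (y \<beta>)) =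
        (\<Sum>y\<in>T. \<Prod>\<gamma>\<in>H. \<Sum>i\<in>I. c \<gamma> i * y \<gamma> powi e \<gamma> i) / card T"
      by (simp add: sum_divide_distrib)
    also have "\<dots> = (\<Prod>\<gamma>\<in>H. \<Sum>i\<in>{i\<in>I. e \<gamma> i = 0}. c \<gamma> i)"
      using card_T_pos finI assms(1,2)
      by (subst independent_sum_prod) (auto simp: e_def I_def)
    also have "\<dots> = (\<Prod>\<gamma>\<in>H. if \<gamma> = \<beta> then real n / (real n + 1) * u \<beta> else 1)"
      by (intro prod.cong refl) (auto simp: e_def diagonal[simplified] subdiagonal[simplified] cong: conj_cong)
    also have "\<dots> = of_real (real n / (real n + 1)) * u \<beta>"
      using \<beta> assms(2) by simp
    finally show "(\<Sum>y\<in>T. of_real (K y / card T) * cnj (y \<beta>)) = of_real (real n / (real n + 1)) * u \<beta>" .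
  qed
qed

lemma independent_interpolation:
  fixes B :: real
  assumes "independent_of_degree (Suc n) H" "finite H" "1 \<le> n"
    and \<phi>: "\<And>\<gamma>. \<gamma> \<in> H \<Longrightarrow> cmod (\<phi> \<gamma>) \<le> B" and "0 \<le> B"
  obtains w where "(\<Sum>y\<in>T. cmod (w y)) \<le> (1 + 1 / n) * B"
    "\<And>\<gamma>. \<gamma> \<in> H \<Longrightarrow> (\<Sum>y\<in>T. w y * cnj (y \<gamma>)) = \<phi> \<gamma>"
proof -
  have "\<exists>u v. cmod u = 1 \<and> cmod v = 1 \<and> \<phi> \<gamma> = of_real B * ((u + v) / 2)" if "\<gamma> \<in> H" for \<gamma>
  proof (cases "B = 0")
    case True
    then show ?thesis using \<phi>[OF that] by (auto intro!: exI[of _ 1])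
  next
    case False
    then have "cmod (\<phi> \<gamma> / of_real B) \<le> 1"
      using \<phi>[OF that] \<open>0 \<le> B\<close> by (simp add: norm_divide)
    then obtain u v where "cmod u = 1" "cmod v = 1" "\<phi> \<gamma> / of_real B = (u + v) / 2"
      by (rule midpoint_of_unimodular)
    with False show ?thesis
      by (intro exI[of _ u] exI[of _ v]) (simp add: field_simps)
  qed
  then obtain u v where uv: "\<And>\<gamma>. \<gamma> \<in> H \<Longrightarrow> cmod (u \<gamma>) = 1" "\<And>\<gamma>. \<gamma> \<in> H \<Longrightarrow> cmod (v \<gamma>) = 1"
      "\<And>\<gamma>. \<gamma> \<in> H \<Longrightarrow> \<phi> \<gamma> = of_real B * ((u \<gamma> + v \<gamma>) / 2)"
    by metis
  have "\<exists>w. (\<Sum>y\<in>T. cmod (w y)) = 1 \<and>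
      (\<forall>\<gamma>\<in>H. (\<Sum>y\<in>T. w y * cnj (y \<gamma>)) = of_real (real n / (real n + 1)) * s \<gamma>)"
    if "s = u \<or> s = v" for s
    using that uv(1,2) by (intro riesz_product[OF assms(1,2)]) auto
  note ex = this[of u, simplified] this[of v, simplified]
  from ex(1) obtain f where f: "(\<Sum>y\<in>T. cmod (f y)) = 1"
      "\<And>\<gamma>. \<gamma> \<in> H \<Longrightarrow> (\<Sum>y\<in>T. f y * cnj (y \<gamma>)) = of_real (real n / (real n + 1)) * u \<gamma>"
    by auto
  from ex(2) obtain g where g: "(\<Sum>y\<in>T. cmod (g y)) = 1"
      "\<And>\<gamma>. \<gamma> \<in> H \<Longrightarrow> (\<Sum>y\<in>T. g y * cnj (y \<gamma>)) = of_real (real n / (real n + 1)) * v \<gamma>"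
    by auto
  define a where "a = (1 + 1 / n) * B / 2"
  have a0: "0 \<le> a" using \<open>0 \<le> B\<close> by (simp add: a_def)
  have a: "a * (real n / (real n + 1)) = B / 2"
  proof -
    have "(1 + 1 / real n) * (real n / (real n + 1)) = 1"
      using assms(3) by (simp add: divide_simps)
    moreover have "a * (real n / (real n + 1)) = (1 + 1 / real n) * (real n / (real n + 1)) * (B / 2)"
      by (simp add: a_def mult_ac)
    ultimately show ?thesis
      by (simp only: mult_1)
  qed
  show thesis
  proof
    have "(\<Sum>y\<in>T. cmod (of_real a * (f y + g y))) \<le> (\<Sum>y\<in>T. a * (cmod (f y) + cmod (g y)))"
      using a0 by (intro sum_mono) (simp add: norm_mult mult_left_mono norm_triangle_ineq)
    also have "\<dots> = a * 2"
      by (simp add: sum.distrib f(1) g(1) flip: sum_distrib_left)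
    finally show "(\<Sum>y\<in>T. cmod (of_real a * (f y + g y))) \<le> (1 + 1 / n) * B"
      by (simp add: a_def)
    fix \<gamma> assume \<gamma>: "\<gamma> \<in> H"
    have "(\<Sum>y\<in>T. of_real a * (f y + g y) * cnj (y \<gamma>)) =
        of_real a * ((\<Sum>y\<in>T. f y * cnj (y \<gamma>)) + (\<Sum>y\<in>T. g y * cnj (y \<gamma>)))"
      by (simp add: sum.distrib distrib_left distrib_right sum_distrib_left mult_ac)
    also have "\<dots> = of_real (a * (real n / (real n + 1))) * (u \<gamma> + v \<gamma>)"
      unfolding f(2)[OF \<gamma>] g(2)[OF \<gamma>] of_real_mult by (simp only: distrib_left mult.assoc)
    also have "\<dots> = \<phi> \<gamma>"
      unfolding a uv(3)[OF \<gamma>] by simp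
    finally show "(\<Sum>y\<in>T. of_real a * (f y + g y) * cnj (y \<gamma>)) = \<phi> \<gamma>" .
  qed
qed

end

section \<open>Integrals of functions with finite range\<close>

definition signed_measure :: "'x measure \<Rightarrow> ('x set \<Rightarrow> real) \<Rightarrow> bool" where
  "signed_measure M \<nu> \<longleftrightarrow>
     (\<forall>A :: nat \<Rightarrow> 'x set. range A \<subseteq> sets M \<longrightarrow> disjoint_family A \<longrightarrow>
        (\<lambda>n. \<nu> (A n)) sums \<nu> (\<Union>n. A n))"

lemma signed_measure_uminus: "signed_measure M \<nu> \<Longrightarrow> signed_measure M (\<lambda>A. - \<nu> A)"
  by (auto simp: signed_measure_def intro: sums_minus)

lemma signed_measure_empty:
  assumes "signed_measure M \<nu>"
  shows "\<nu> {} = 0"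
proof -
  have "(\<lambda>n :: nat. \<nu> {}) sums \<nu> {}"
    using assms[unfolded signed_measure_def, rule_format, of "\<lambda>_. {}"]
    by (simp add: disjoint_family_on_def)
  then show ?thesis
    using sums_summable summable_const_iff by blast
qed

lemma signed_measure_Un:
  assumes "signed_measure M \<nu>" "A \<in> sets M" "B \<in> sets M" "A \<inter> B = {}"
  shows "\<nu> (A \<union> B) = \<nu> A + \<nu> B"
proof -
  have "range (binaryset A B) \<subseteq> sets M" "disjoint_family (binaryset A B)"
    using assms by (auto simp: binaryset_def disjoint_family_on_def)
  then have "(\<lambda>n. \<nu> (binaryset A B n)) sums \<nu> (A \<union> B)"
    using assms(1) unfolding signed_measure_def by (metis UN_binaryset_eq)
  moreover have "(\<lambda>n. \<nu> (binaryset A B n)) sums (\<nu> A + \<nu> B)"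
    by (rule binaryset_sums) (rule signed_measure_empty[OF assms(1)])
  ultimately show ?thesis
    by (rule sums_unique2)
qed

definition pos_variation :: "'x measure \<Rightarrow> ('x set \<Rightarrow> real) \<Rightarrow> 'x set \<Rightarrow> ennreal" where
  "pos_variation M \<nu> A = (SUP B \<in> {B \<in> sets M. B \<subseteq> A}. ennreal (\<nu> B))"

lemma pos_variation_upper:
  "B \<in> sets M \<Longrightarrow> B \<subseteq> A \<Longrightarrow> ennreal (\<nu> B) \<le> pos_variation M \<nu> A"
  unfolding pos_variation_def by (rule SUP_upper) simp

lemma pos_variation_least:
  "(\<And>B. B \<in> sets M \<Longrightarrow> B \<subseteq> A \<Longrightarrow> ennreal (\<nu> B) \<le> c) \<Longrightarrow> pos_variation M \<nu> A \<le> c"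
  unfolding pos_variation_def by (rule SUP_least) simp

lemma pos_variation_mono: "A \<subseteq> A' \<Longrightarrow> pos_variation M \<nu> A \<le> pos_variation M \<nu> A'"
  by (intro pos_variation_least pos_variation_upper) auto

text \<open>A subset of \<open>A\<close> and a subset of \<open>A'\<close> are disjoint, and their union competes for the supremum on the
  right. A set of negative measure may be replaced by the empty set.\<close>

lemma pos_variation_superadditive:
  assumes "signed_measure M \<nu>" "A \<inter> A' = {}"
  shows "pos_variation M \<nu> A + pos_variation M \<nu> A' \<le> pos_variation M \<nu> (A \<union> A')"
proof -
  have ne: "{B \<in> sets M. B \<subseteq> A} \<noteq> {}" for A
    by (auto intro!: exI[of _ "{}"])
  have le: "ennreal (\<nu> B) + ennreal (\<nu> B') \<le> pos_variation M \<nu> (A \<union> A')"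
    if B: "B \<in> sets M" "B \<subseteq> A" and B': "B' \<in> sets M" "B' \<subseteq> A'" for B B'
  proof (cases "\<nu> B \<le> 0 \<or> \<nu> B' \<le> 0")
    case True
    moreover have "ennreal (\<nu> B) \<le> pos_variation M \<nu> (A \<union> A')" "ennreal (\<nu> B') \<le> pos_variation M \<nu> (A \<union> A')"
      using B B' by (auto intro!: pos_variation_upper)
    ultimately show ?thesis
      by (auto simp: ennreal_neg)
  next
    case False
    then have "ennreal (\<nu> B) + ennreal (\<nu> B') = ennreal (\<nu> B + \<nu> B')"
      by (simp add: ennreal_plus)
    also have "\<nu> B + \<nu> B' = \<nu> (B \<union> B')"
      using assms B B' by (intro signed_measure_Un[symmetric]) auto
    also have "ennreal \<dots> \<le> pos_variation M \<nu> (A \<union> A')"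
      using B B' by (intro pos_variation_upper) auto
    finally show ?thesis .
  qed
  have "ennreal (\<nu> B) + pos_variation M \<nu> A' \<le> pos_variation M \<nu> (A \<union> A')"
    if "B \<in> sets M" "B \<subseteq> A" for B
    unfolding pos_variation_def[of _ _ A'] ennreal_SUP_add_right[OF ne]
    using le that by (intro SUP_least) auto
  then show ?thesis
    unfolding pos_variation_def[of _ _ A] ennreal_SUP_add_left[OF ne, symmetric]
    by (intro SUP_least) auto
qed

lemma ennreal_sums_le_suminf:
  assumes "f sums s"
  shows "ennreal s \<le> (\<Sum>n. ennreal (f n))"
proof (cases "(\<Sum>n. ennreal (f n)) = top_class.top")
  case False
  define g where "g n = max 0 (f n)" for n
  have fg: "ennreal (f n) = ennreal (g n)" for n
    by (simp add: g_def max_def ennreal_neg)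
  have "summable g"
    using False by (intro summable_suminf_not_top) (auto simp: fg g_def)
  then have "(\<Sum>n. ennreal (g n)) = ennreal (suminf g)"
    by (intro suminf_ennreal_eq summable_sums) (simp add: g_def)
  moreover have "s \<le> suminf g"
    by (rule sums_le[OF _ assms summable_sums[OF \<open>summable g\<close>]]) (simp add: g_def)
  ultimately show ?thesis
    by (simp add: fg ennreal_leI)
qed simp

lemma emeasure_jordan_pos:
  assumes "signed_measure M \<nu>" "A \<in> sets M"
  shows "emeasure (jordan_pos M \<nu>) A = pos_variation M \<nu> A"
  unfolding jordan_pos_def pos_variation_def[symmetric]
proof (rule emeasure_measure_of_sigma)
  show "sigma_algebra (space M) (sets M)"
    by (rule sets.sigma_algebra_axioms)
  show "positive (sets M) (pos_variation M \<nu>)"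
    unfolding positive_def
    by (intro antisym pos_variation_least) (auto simp: signed_measure_empty[OF assms(1)])
  show "countably_additive (sets M) (pos_variation M \<nu>)"
    unfolding countably_additive_def
  proof (intro allI impI antisym)
    fix A :: "nat \<Rightarrow> _"
    assume A: "range A \<subseteq> sets M" "disjoint_family A"
    have "(\<Sum>n<N. pos_variation M \<nu> (A n)) \<le> pos_variation M \<nu> (\<Union>n<N. A n)" for N
    proof (induction N)
      case (Suc N)
      have "(\<Union>n<N. A n) \<inter> A N = {}"
      proof -
        have "A n \<inter> A N = {}" if "n < N" for n
          using that by (intro disjoint_family_onD[OF A(2)]) auto
        then show ?thesis by blast
      qed
      then have "pos_variation M \<nu> (\<Union>n<N. A n) + pos_variation M \<nu> (A N) \<le>
          pos_variation M \<nu> ((\<Union>n<N. A n) \<union> A N)"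
        by (rule pos_variation_superadditive[OF assms(1)])
      moreover have "(\<Union>n<N. A n) \<union> A N = (\<Union>n<Suc N. A n)"
        by (auto simp: lessThan_Suc)
      ultimately show ?case
        using order_trans[OF add_right_mono[OF Suc.IH]] by simp
    qed simp
    also have "pos_variation M \<nu> (\<Union>n<N. A n) \<le> pos_variation M \<nu> (\<Union>n. A n)" for N
      by (intro pos_variation_mono) auto
    finally have partial: "(\<Sum>n<N. pos_variation M \<nu> (A n)) \<le> pos_variation M \<nu> (\<Union>n. A n)" for N .
    then show "(\<Sum>n. pos_variation M \<nu> (A n)) \<le> pos_variation M \<nu> (\<Union>n. A n)"
      by (intro suminf_le_const summableI) 
    show "pos_variation M \<nu> (\<Union>n. A n) \<le> (\<Sum>n. pos_variation M \<nu> (A n))"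
    proof (rule pos_variation_least)
      fix B assume B: "B \<in> sets M" "B \<subseteq> (\<Union>n. A n)"
      have "range (\<lambda>n. B \<inter> A n) \<subseteq> sets M" "disjoint_family (\<lambda>n. B \<inter> A n)"
        using A B by (auto simp: disjoint_family_on_def)
      then have "(\<lambda>n. \<nu> (B \<inter> A n)) sums \<nu> (\<Union>n. B \<inter> A n)"
        using assms(1) unfolding signed_measure_def by blast
      moreover have "(\<Union>n. B \<inter> A n) = B"
        using B by auto
      ultimately have "ennreal (\<nu> B) \<le> (\<Sum>n. ennreal (\<nu> (B \<inter> A n)))"
        using ennreal_sums_le_suminf by metis
      also have "\<dots> \<le> (\<Sum>n. pos_variation M \<nu> (A n))"
        using A B by (intro suminf_le pos_variation_upper summableI) auto
      finally show "ennreal (\<nu> B) \<le> (\<Sum>n. pos_variation M \<nu> (A n))" .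
    qed
  qed
qed (use assms in auto)

lemma sets_jordan_pos [simp]: "sets (jordan_pos M \<nu>) = sets M"
  and space_jordan_pos [simp]: "space (jordan_pos M \<nu>) = space M"
  by (simp_all add: jordan_pos_def)

context
  fixes M :: "'x measure" and \<nu> :: "'x set \<Rightarrow> real" and V :: real
  assumes signed: "signed_measure M \<nu>" and bounded: "\<And>B. B \<in> sets M \<Longrightarrow> \<bar>\<nu> B\<bar> \<le> V"
begin

lemma finite_measure_jordan_pos: "finite_measure (jordan_pos M \<nu>)"
proof
  have "pos_variation M \<nu> (space M) \<le> ennreal V"
    using bounded abs_le_D1 by (intro pos_variation_least ennreal_leI) blast
  then have "pos_variation M \<nu> (space M) \<noteq> \<infinity>"
    by (metis ennreal_less_top infinity_ennreal_def leD)
  then show "emeasure (jordan_pos M \<nu>) (space (jordan_pos M \<nu>)) \<noteq> \<infinity>"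
    by (simp add: emeasure_jordan_pos[OF signed])
qed

lemma measure_jordan_pos_upper:
  assumes "A \<in> sets M" "B \<in> sets M" "B \<subseteq> A"
  shows "\<nu> B \<le> measure (jordan_pos M \<nu>) A"
proof -
  interpret finite_measure "jordan_pos M \<nu>" by (rule finite_measure_jordan_pos)
  have "ennreal (\<nu> B) \<le> ennreal (measure (jordan_pos M \<nu>) A)"
    using pos_variation_upper[OF assms(2,3), of \<nu>] emeasure_jordan_pos[OF signed assms(1)]
    by (simp add: emeasure_eq_measure)
  then show ?thesis
    by (simp add: ennreal_le_iff)
qed

lemma measure_jordan_pos_least:
  assumes "A \<in> sets M" "\<And>B. B \<in> sets M \<Longrightarrow> B \<subseteq> A \<Longrightarrow> \<nu> B \<le> c"
  shows "measure (jordan_pos M \<nu>) A \<le> c"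
proof -
  interpret finite_measure "jordan_pos M \<nu>" by (rule finite_measure_jordan_pos)
  have "0 \<le> c"
    using assms(2)[of "{}"] signed_measure_empty[OF signed] by simp
  moreover have "ennreal (measure (jordan_pos M \<nu>) A) \<le> ennreal c"
    unfolding emeasure_eq_measure[symmetric] emeasure_jordan_pos[OF signed assms(1)]
    by (intro pos_variation_least ennreal_leI assms)
  ultimately show ?thesis
    by (simp add: ennreal_le_iff)
qed

end

text \<open>As \<open>\<nu> B = \<nu> A - \<nu> (A - B)\<close>, the supremum of \<open>\<nu>\<close> over the measurable
  subsets of \<open>A\<close> is \<open>\<nu> A\<close> plus the supremum of \<open>- \<nu>\<close>.\<close>

lemma jordan_decomposition:
  assumes signed: "signed_measure M \<nu>" and bounded: "\<And>B. B \<in> sets M \<Longrightarrow> \<bar>\<nu> B\<bar> \<le> V"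
    and A: "A \<in> sets M"
  shows "measure (jordan_pos M \<nu>) A - measure (jordan_pos M (\<lambda>A. - \<nu> A)) A = \<nu> A"
proof -
  note signed' = signed_measure_uminus[OF signed]
  have bounded': "\<And>B. B \<in> sets M \<Longrightarrow> \<bar>- \<nu> B\<bar> \<le> V"
    using bounded by simp
  have diff: "\<nu> B + \<nu> (A - B) = \<nu> A" if "B \<in> sets M" "B \<subseteq> A" for B
    using signed_measure_Un[OF signed that(1), of "A - B"] that A by (simp add: Un_absorb1)
  have "measure (jordan_pos M \<nu>) A \<le> \<nu> A + measure (jordan_pos M (\<lambda>A. - \<nu> A)) A"
  proof (rule measure_jordan_pos_least[OF signed bounded A])
    fix B assume B: "B \<in> sets M" "B \<subseteq> A"
    then show "\<nu> B \<le> \<nu> A + measure (jordan_pos M (\<lambda>A. - \<nu> A)) A"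
      using measure_jordan_pos_upper[OF signed' bounded' A, of "A - B"] A diff[OF B] by auto
  qed
  moreover have "measure (jordan_pos M (\<lambda>A. - \<nu> A)) A \<le> - \<nu> A + measure (jordan_pos M \<nu>) A"
  proof (rule measure_jordan_pos_least[OF signed' bounded' A])
    fix B assume B: "B \<in> sets M" "B \<subseteq> A"
    then show "- \<nu> B \<le> - \<nu> A + measure (jordan_pos M \<nu>) A"
      using measure_jordan_pos_upper[OF signed bounded A, of "A - B"] A diff[OF B] by auto
  qed
  ultimately show ?thesis by linarith
qed

lemma (in finite_measure) integral_finite_range:
  fixes g :: "'k \<Rightarrow> complex"
  assumes "finite K" and q: "\<And>x. x \<in> space M \<Longrightarrow> q x \<in> K"
    and fibre: "\<And>k. k \<in> K \<Longrightarrow> {x \<in> space M. q x = k} \<in> sets M"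
  shows "(\<integral>x. g (q x) \<partial>M) = (\<Sum>k\<in>K. g k * measure M {x \<in> space M. q x = k})"
proof -
  have "(\<integral>x. g (q x) \<partial>M) = (\<integral>x. (\<Sum>k\<in>K. indicat_real {x \<in> space M. q x = k} x *\<^sub>R g k) \<partial>M)"
  proof (intro Bochner_Integration.integral_cong refl)
    fix x assume x: "x \<in> space M"
    then have "(\<Sum>k\<in>K. indicat_real {x \<in> space M. q x = k} x *\<^sub>R g k) = (\<Sum>k\<in>K. if q x = k then g k else 0)"
      by (intro sum.cong) auto
    then show "g (q x) = (\<Sum>k\<in>K. indicat_real {x \<in> space M. q x = k} x *\<^sub>R g k)"
      using assms(1) q[OF x] by simp
  qed
  also have "\<dots> = (\<Sum>k\<in>K. (\<integral>x. indicat_real {x \<in> space M. q x = k} x *\<^sub>R g k \<partial>M))"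
    using fibre by (intro Bochner_Integration.integral_sum integrable_scaleR_left integrable_real_indicator)
      (auto simp: emeasure_eq_measure)
  also have "\<dots> = (\<Sum>k\<in>K. g k * measure M {x \<in> space M. q x = k})"
    using fibre by (intro sum.cong refl) (simp add: scaleR_conv_of_real mult.commute)
  finally show ?thesis .
qed

lemma signed_integral_finite_range:
  fixes g :: "'k \<Rightarrow> complex"
  assumes signed: "signed_measure M \<nu>" and bounded: "\<And>B. B \<in> sets M \<Longrightarrow> \<bar>\<nu> B\<bar> \<le> V"
    and K: "finite K" "\<And>x. x \<in> space M \<Longrightarrow> q x \<in> K"
    and fibre: "\<And>k. k \<in> K \<Longrightarrow> {x \<in> space M. q x = k} \<in> sets M"
  shows "signed_integral M \<nu> (\<lambda>x. g (q x)) = (\<Sum>k\<in>K. g k * \<nu> {x \<in> space M. q x = k})"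
proof -
  note signed' = signed_measure_uminus[OF signed]
  have bounded': "\<And>B. B \<in> sets M \<Longrightarrow> \<bar>- \<nu> B\<bar> \<le> V"
    using bounded by simp
  have "signed_integral M \<nu> (\<lambda>x. g (q x)) =
     (\<Sum>k\<in>K. g k * measure (jordan_pos M \<nu>) {x \<in> space M. q x = k}) -
     (\<Sum>k\<in>K. g k * measure (jordan_pos M (\<lambda>A. - \<nu> A)) {x \<in> space M. q x = k})"
    unfolding signed_integral_def
    using finite_measure.integral_finite_range[OF finite_measure_jordan_pos[OF signed bounded], of K q g]
      finite_measure.integral_finite_range[OF finite_measure_jordan_pos[OF signed' bounded'], of K q g] K fibre
    by simp
  also have "\<dots> = (\<Sum>k\<in>K. g k * of_real (measure (jordan_pos M \<nu>) {x \<in> space M. q x = k} -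
        measure (jordan_pos M (\<lambda>A. - \<nu> A)) {x \<in> space M. q x = k}))"
    by (simp add: sum_subtractf right_diff_distrib)
  also have "\<dots> = (\<Sum>k\<in>K. g k * \<nu> {x \<in> space M. q x = k})"
    using jordan_decomposition[OF signed bounded fibre] by (intro sum.cong refl) simp
  finally show ?thesis .
qed

lemma complex_measure_Re_Im:
  assumes "complex_measure M \<mu>"
  shows "signed_measure M (\<lambda>A. Re (\<mu> A))" "signed_measure M (\<lambda>A. Im (\<mu> A))"
  using assms unfolding complex_measure_def signed_measure_def sums_complex_iff by auto

lemma cmod_le_total_variation:
  assumes "B \<in> sets M"
  shows "ennreal (cmod (\<mu> B)) \<le> total_variation M \<mu> (space M)"
proof -
  have P: "{B, space M - B} \<in> {P. finite P \<and> disjoint P \<and> P \<subseteq> sets M \<and> \<Union>P = space M}"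
    using assms sets.sets_into_space by (fastforce simp: disjoint_def)
  have "ennreal (cmod (\<mu> B)) \<le> (\<Sum>B\<in>{B, space M - B}. ennreal (cmod (\<mu> B)))"
    by (intro sum_le_included[where s = "{B}" and i = id, simplified]) auto
  also have "\<dots> \<le> total_variation M \<mu> (space M)"
    unfolding total_variation_def by (rule SUP_upper[OF P])
  finally show ?thesis .
qed

text \<open>Only an integrand that factors through a map \<open>q\<close> with finitely many values occurs below: the value of
  a character at an element of finite order is a root of unity.\<close>

lemma complex_integral_finite_range:
  fixes g :: "'k \<Rightarrow> complex"
  assumes "complex_measure M \<mu>" and V: "total_variation M \<mu> (space M) \<le> ennreal V"
    and K: "finite K" "\<And>x. x \<in> space M \<Longrightarrow> q x \<in> K"
    and fibre: "\<And>k. k \<in> K \<Longrightarrow> {x \<in> space M. q x = k} \<in> sets M"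
  shows "complex_integral M \<mu> (\<lambda>x. g (q x)) = (\<Sum>k\<in>K. g k * \<mu> {x \<in> space M. q x = k})"
proof -
  have le: "cmod (\<mu> B) \<le> max 0 V" if "B \<in> sets M" for B
  proof -
    have "ennreal (cmod (\<mu> B)) \<le> ennreal (max 0 V)"
      by (rule order_trans[OF cmod_le_total_variation[OF that] order_trans[OF V]])
         (simp add: ennreal_leI)
    then show ?thesis by (simp add: ennreal_le_iff)
  qed
  have "\<bar>Re (\<mu> B)\<bar> \<le> max 0 V" "\<bar>Im (\<mu> B)\<bar> \<le> max 0 V" if "B \<in> sets M" for B
    using le[OF that] abs_Re_le_cmod[of "\<mu> B"] abs_Im_le_cmod[of "\<mu> B"] by linarith+
  note parts = signed_integral_finite_range[OF complex_measure_Re_Im(1)[OF assms(1)] this(1) K fibre, where g = g]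
    signed_integral_finite_range[OF complex_measure_Re_Im(2)[OF assms(1)] this(2) K fibre, where g = g]
  have "complex_integral M \<mu> (\<lambda>x. g (q x)) =
      (\<Sum>k\<in>K. g k * Re (\<mu> {x \<in> space M. q x = k})) +
      \<i> * (\<Sum>k\<in>K. g k * Im (\<mu> {x \<in> space M. q x = k}))"
    by (simp only: complex_integral_def parts)
  also have "\<dots> = (\<Sum>k\<in>K. g k * (Re (\<mu> {x \<in> space M. q x = k}) + \<i> * Im (\<mu> {x \<in> space M. q x = k})))"
    by (simp add: sum_distrib_left sum.distrib distrib_left mult_ac)
  also have "\<dots> = (\<Sum>k\<in>K. g k * \<mu> {x \<in> space M. q x = k})"
    by (simp add: complex_eq[symmetric])
  finally show ?thesis .
qed

section \<open>Point masses\<close>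

lemma sets_borel_sets_of: "sets (borel_sets_of X) = sigma_sets (topspace X) {U. openin X U}"
  and space_borel_sets_of [simp]: "space (borel_sets_of X) = topspace X"
  unfolding borel_sets_of_def
  by (subst sets_measure_of space_measure_of; use openin_subset in auto)+

lemma openin_in_borel: "openin X U \<Longrightarrow> U \<in> sets (borel_sets_of X)"
  by (simp add: sets_borel_sets_of sigma_sets.Basic)

lemma closedin_in_borel:
  assumes "closedin X A"
  shows "A \<in> sets (borel_sets_of X)"
proof -
  have "topspace X - (topspace X - A) \<in> sets (borel_sets_of X)"
    using assms openin_in_borel[of X "topspace X - A"] sets.compl_sets[of _ "borel_sets_of X"]
    by (simp add: closedin_def)
  moreover have "topspace X - (topspace X - A) = A"
    using assms closedin_subset by blast
  ultimately show ?thesis by simp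
qed

definition atomic_measure :: "'x set \<Rightarrow> ('x \<Rightarrow> complex) \<Rightarrow> 'x set \<Rightarrow> complex" where
  "atomic_measure S w A = (\<Sum>x\<in>S \<inter> A. w x)"

lemma complex_measure_atomic:
  fixes M :: "'x measure" and w :: "'x \<Rightarrow> complex"
  assumes "finite S"
  shows "complex_measure M (atomic_measure S w)"
  unfolding complex_measure_def
proof (intro allI impI)
  fix A :: "nat \<Rightarrow> 'x set"
  assume A: "disjoint_family A"
  have atomic: "atomic_measure S w B = (\<Sum>x\<in>S. indicat_real B x *\<^sub>R w x)" for B
  proof -
    have "atomic_measure S w B = (\<Sum>x\<in>S. if x \<in> B then w x else 0)"
      unfolding atomic_measure_def by (rule sum.inter_restrict[OF assms])
    also have "\<dots> = (\<Sum>x\<in>S. indicat_real B x *\<^sub>R w x)"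
      by (intro sum.cong) auto
    finally show ?thesis .
  qed
  have "(\<lambda>n. indicat_real (A n) x *\<^sub>R w x) sums (indicat_real (\<Union>n. A n) x *\<^sub>R w x)" for x
    using indicator_sums[of A x] A by (intro sums_scaleR_left) (auto simp: disjoint_family_on_def)
  then show "(\<lambda>n. atomic_measure S w (A n)) sums atomic_measure S w (\<Union>n. A n)"
    unfolding atomic by (intro sums_sum)
qed

lemma total_variation_atomic_le:
  assumes "finite S"
  shows "total_variation M (atomic_measure S w) A \<le> ennreal (\<Sum>x\<in>S \<inter> A. cmod (w x))"
  unfolding total_variation_def
proof (rule SUP_least, clarify)
  fix P assume P: "finite P" "disjoint P" "A = \<Union>P"
  have "(\<Sum>B\<in>P. ennreal (cmod (atomic_measure S w B))) = ennreal (\<Sum>B\<in>P. cmod (atomic_measure S w B))"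
    by simp
  also have "(\<Sum>B\<in>P. cmod (atomic_measure S w B)) \<le> (\<Sum>B\<in>P. \<Sum>x\<in>S \<inter> B. cmod (w x))"
    unfolding atomic_measure_def by (intro sum_mono norm_sum)
  also have "\<dots> = (\<Sum>x\<in>(\<Union>B\<in>P. S \<inter> B). cmod (w x))"
    using P assms by (intro sum.UNION_disjoint[symmetric]) (auto simp: disjoint_def)
  also have "(\<Union>B\<in>P. S \<inter> B) = S \<inter> \<Union>P"
    by auto
  finally show "(\<Sum>B\<in>P. ennreal (cmod (atomic_measure S w B))) \<le> ennreal (\<Sum>x\<in>S \<inter> \<Union>P. cmod (w x))"
    by (simp add: ennreal_leI)
qed

context
  fixes X :: "'x topology" and S :: "'x set" and w :: "'x \<Rightarrow> complex"
  assumes t1: "t1_space X" and S: "finite S" "S \<subseteq> topspace X"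
begin

lemma finite_closed_in_t1: "finite A \<Longrightarrow> A \<subseteq> topspace X \<Longrightarrow> closedin X A"
  using t1 t1_space_closedin_finite by blast

lemma total_variation_atomic:
  assumes A: "A \<in> sets (borel_sets_of X)"
  shows "total_variation (borel_sets_of X) (atomic_measure S w) A = ennreal (\<Sum>x\<in>S \<inter> A. cmod (w x))"
proof (rule antisym[OF total_variation_atomic_le[OF S(1)]])
  define P where "P = insert (A - S) ((\<lambda>x. {x}) ` (S \<inter> A))"
  have singleton: "{x} \<in> sets (borel_sets_of X)" if "x \<in> S" for x
    using that S by (intro closedin_in_borel finite_closed_in_t1) auto
  have "A - S \<in> sets (borel_sets_of X)"
    by (intro sets.Diff A closedin_in_borel finite_closed_in_t1 S)
  then have P: "P \<in> {P. finite P \<and> disjoint P \<and> P \<subseteq> sets (borel_sets_of X) \<and> \<Union>P = A}"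
    using S singleton by (auto simp: P_def disjoint_def)
  have "ennreal (\<Sum>x\<in>S \<inter> A. cmod (w x)) = (\<Sum>x\<in>S \<inter> A. ennreal (cmod (atomic_measure S w {x})))"
    by (simp add: atomic_measure_def)
  also have "\<dots> = (\<Sum>B\<in>(\<lambda>x. {x}) ` (S \<inter> A). ennreal (cmod (atomic_measure S w B)))"
    by (simp add: sum.reindex inj_on_def)
  also have "\<dots> \<le> (\<Sum>B\<in>P. ennreal (cmod (atomic_measure S w B)))"
    using P by (intro sum_mono2) (auto simp: P_def)
  also have "\<dots> \<le> total_variation (borel_sets_of X) (atomic_measure S w) A"
    unfolding total_variation_def by (rule SUP_upper[OF P])
  finally show "ennreal (\<Sum>x\<in>S \<inter> A. cmod (w x)) \<le> total_variation (borel_sets_of X) (atomic_measure S w) A" .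
qed

text \<open>For outer regularity, enlarge a Borel set \<open>A\<close> to the complement of the finitely many atoms outside
  \<open>A\<close>. For inner regularity, shrink it to the finite set of its atoms.\<close>

lemma regular_measure_atomic: "regular_measure X (atomic_measure S w)"
  unfolding regular_measure_def
proof (intro ballI conjI)
  fix A assume A: "A \<in> sets (borel_sets_of X)"
  let ?v = "total_variation (borel_sets_of X) (atomic_measure S w)"
  have AX: "A \<subseteq> topspace X"
    using sets.sets_into_space[OF A] by simp
  define U where "U = topspace X - (S - A)"
  have U: "openin X U" "A \<subseteq> U" "S \<inter> U = S \<inter> A"
    using S AX finite_closed_in_t1[of "S - A"] by (auto simp: U_def)
  show "?v A = (INF U\<in>{U. openin X U \<and> A \<subseteq> U}. ?v U)"
  proof (rule antisym)
    show "?v A \<le> (INF U\<in>{U. openin X U \<and> A \<subseteq> U}. ?v U)"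
    proof (rule INF_greatest, clarify)
      fix V assume V: "openin X V" "A \<subseteq> V"
      have "(\<Sum>x\<in>S \<inter> A. cmod (w x)) \<le> (\<Sum>x\<in>S \<inter> V. cmod (w x))"
        using S V by (intro sum_mono2) auto
      then show "?v A \<le> ?v V"
        using A V by (simp add: total_variation_atomic openin_in_borel ennreal_leI)
    qed
    have "(INF U\<in>{U. openin X U \<and> A \<subseteq> U}. ?v U) \<le> ?v U"
      using U by (intro INF_lower) auto
    also have "?v U = ?v A"
      using A U by (simp add: total_variation_atomic openin_in_borel)
    finally show "(INF U\<in>{U. openin X U \<and> A \<subseteq> U}. ?v U) \<le> ?v A" .
  qed
  show "?v A = (SUP K\<in>{K. compactin X K \<and> K \<subseteq> A}. ?v K)"
  proof (rule antisym)
    have "compactin X (S \<inter> A)"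
      using S by (intro finite_imp_compactin) auto
    then have "?v (S \<inter> A) \<le> (SUP K\<in>{K. compactin X K \<and> K \<subseteq> A}. ?v K)"
      by (intro SUP_upper) auto
    moreover have SA: "S \<inter> A \<in> sets (borel_sets_of X)"
      using S by (intro closedin_in_borel finite_closed_in_t1) auto
    ultimately show "?v A \<le> (SUP K\<in>{K. compactin X K \<and> K \<subseteq> A}. ?v K)"
      by (simp only: total_variation_atomic[OF A] total_variation_atomic[OF SA] Int_assoc[symmetric] Int_absorb)
    show "(SUP K\<in>{K. compactin X K \<and> K \<subseteq> A}. ?v K) \<le> ?v A"
    proof (rule SUP_least, clarify)
      fix K assume "K \<subseteq> A"
      have "?v K \<le> ennreal (\<Sum>x\<in>S \<inter> K. cmod (w x))"
        by (rule total_variation_atomic_le[OF S(1)])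
      also have "\<dots> \<le> ennreal (\<Sum>x\<in>S \<inter> A. cmod (w x))"
        using S \<open>K \<subseteq> A\<close> by (intro ennreal_leI sum_mono2) auto
      finally show "?v K \<le> ?v A"
        unfolding total_variation_atomic[OF A] .
    qed
  qed
qed

end

section \<open>Measures on the dual group\<close>

lemma topspace_dual_topology [simp]: "topspace (dual_topology \<Gamma>) = characters \<Gamma>"
  by (auto simp: dual_topology_def characters_def PiE_def)

lemma t1_space_dual_topology: "t1_space (dual_topology \<Gamma>)"
  unfolding dual_topology_def
  by (intro t1_space_subtopology Hausdorff_imp_t1_space)
     (simp add: Hausdorff_space_product_topology)

lemma cmod_character:
  assumes "x \<in> characters \<Gamma>" "\<gamma> \<in> carrier \<Gamma>"
  shows "cmod (x \<gamma>) = 1"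
  using assms by (auto simp: characters_def hom_def circle_group_def Pi_iff)

lemma character_mult:
  assumes "x \<in> characters \<Gamma>" "\<gamma> \<in> carrier \<Gamma>" "\<beta> \<in> carrier \<Gamma>"
  shows "x (\<gamma> \<otimes>\<^bsub>\<Gamma>\<^esub> \<beta>) = x \<gamma> * x \<beta>"
  using assms by (auto simp: characters_def hom_def circle_group_def)

lemma (in group) character_pow:
  assumes "x \<in> characters G" "\<gamma> \<in> carrier G"
  shows "x (\<gamma> [^] (n :: nat)) = x \<gamma> ^ n"
proof (induction n)
  case 0
  have "x \<one> * x \<one> = x \<one>"
    using character_mult[OF assms(1), of \<one> \<one>] by simp
  moreover have "x \<one> \<noteq> 0"
    using cmod_character[OF assms(1), of \<one>] by auto
  ultimately show ?case by simp
next
  case (Suc n)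
  then show ?case
    using assms by (simp add: character_mult)
qed

lemma one_mem_characters: "group \<Gamma> \<Longrightarrow> (\<lambda>\<gamma>\<in>carrier \<Gamma>. 1) \<in> characters \<Gamma>"
  by (auto simp: characters_def hom_def circle_group_def group.is_monoid monoid.m_closed)

lemma mult_mem_characters:
  "group \<Gamma> \<Longrightarrow> x \<in> characters \<Gamma> \<Longrightarrow> y \<in> characters \<Gamma> \<Longrightarrow>
     (\<lambda>\<gamma>\<in>carrier \<Gamma>. x \<gamma> * y \<gamma>) \<in> characters \<Gamma>"
  by (auto simp: characters_def hom_def circle_group_def Pi_iff norm_mult group.is_monoid monoid.m_closed)

definition torsion_set :: "('a, 'b) monoid_scheme \<Rightarrow> 'a set \<Rightarrow> bool" where
  "torsion_set \<Gamma> F \<longleftrightarrow> F \<subseteq> carrier \<Gamma> \<and> (\<forall>\<gamma>\<in>F. \<exists>n::nat. 0 < n \<and> \<gamma> [^]\<^bsub>\<Gamma>\<^esub> n = \<one>\<^bsub>\<Gamma>\<^esub>)"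

lemma finite_restrict_characters:
  assumes "group \<Gamma>" "finite F" "torsion_set \<Gamma> F"
  shows "finite ((\<lambda>x. restrict x F) ` characters \<Gamma>)"
proof -
  have "\<forall>\<gamma>\<in>F. \<exists>n::nat. 0 < n \<and> \<gamma> [^]\<^bsub>\<Gamma>\<^esub> n = \<one>\<^bsub>\<Gamma>\<^esub>"
    using assms(3) by (simp add: torsion_set_def)
  then obtain n :: "'a \<Rightarrow> nat" where n: "\<And>\<gamma>. \<gamma> \<in> F \<Longrightarrow> 0 < n \<gamma>" "\<And>\<gamma>. \<gamma> \<in> F \<Longrightarrow> \<gamma> [^]\<^bsub>\<Gamma>\<^esub> n \<gamma> = \<one>\<^bsub>\<Gamma>\<^esub>"
    by metis
  have root: "x \<gamma> ^ n \<gamma> = 1" if "x \<in> characters \<Gamma>" "\<gamma> \<in> F" for x \<gamma>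
  proof -
    have \<gamma>: "\<gamma> \<in> carrier \<Gamma>" using that assms(3) by (auto simp: torsion_set_def)
    have "x \<gamma> ^ n \<gamma> = x (\<gamma> [^]\<^bsub>\<Gamma>\<^esub> n \<gamma>)"
      using group.character_pow[OF assms(1) that(1) \<gamma>] by simp
    also have "\<dots> = x (\<gamma> [^]\<^bsub>\<Gamma>\<^esub> (0::nat))"
      using n(2)[OF that(2)] by simp
    also have "\<dots> = 1"
      using group.character_pow[OF assms(1) that(1) \<gamma>, of 0] by (simp del: nat_pow_0)
    finally show ?thesis .
  qed
  have "(\<lambda>x. restrict x F) ` characters \<Gamma> \<subseteq> (\<Pi>\<^sub>E \<gamma>\<in>F. {z. z ^ n \<gamma> = 1})"
    using root by (auto simp: PiE_iff)
  moreover have "finite (\<Pi>\<^sub>E \<gamma>\<in>F. {z :: complex. z ^ n \<gamma> = 1})"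
    using assms(2) n(1) by (intro finite_PiE) (auto intro: finite_roots_unity simp: Suc_le_eq)
  ultimately show ?thesis
    by (rule finite_subset)
qed

lemma restriction_fibre_measurable:
  assumes "finite F" "F \<subseteq> carrier \<Gamma>"
  shows "{x \<in> characters \<Gamma>. restrict x F = k} \<in> sets (borel_sets_of (dual_topology \<Gamma>))"
proof (cases "k \<in> extensional F")
  case True
  have "closedin (dual_topology \<Gamma>) {x \<in> topspace (dual_topology \<Gamma>). x \<gamma> \<in> {k \<gamma>}}" if "\<gamma> \<in> F" for \<gamma>
  proof (rule closedin_continuous_map_preimage)
    show "continuous_map (dual_topology \<Gamma>) euclidean (\<lambda>x. x \<gamma>)"
      unfolding dual_topology_def using that assms
      by (intro continuous_map_from_subtopology continuous_map_product_projection) auto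
  qed simp
  moreover have "closedin (dual_topology \<Gamma>) (characters \<Gamma>)"
    by (metis closedin_topspace topspace_dual_topology)
  ultimately have "closedin (dual_topology \<Gamma>) (topspace (dual_topology \<Gamma>) \<inter> (\<Inter>\<gamma>\<in>F. {x \<in> characters \<Gamma>. x \<gamma> = k \<gamma>}))"
    using assms(1) by (cases "F = {}") (auto intro!: closedin_Int closedin_INT)
  moreover have "topspace (dual_topology \<Gamma>) \<inter> (\<Inter>\<gamma>\<in>F. {x \<in> characters \<Gamma>. x \<gamma> = k \<gamma>}) =
      {x \<in> characters \<Gamma>. restrict x F = k}"
    using True by (auto simp: restrict_def extensional_def fun_eq_iff)
  ultimately have "closedin (dual_topology \<Gamma>) {x \<in> characters \<Gamma>. restrict x F = k}"
    by (simp only:)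
  then show ?thesis
    by (rule closedin_in_borel)
next
  case False
  then have "{x \<in> characters \<Gamma>. restrict x F = k} = {}" by auto
  then show ?thesis by (simp only: sets.empty_sets)
qed

text \<open>The transform of a measure at the elements of \<open>F\<close> is that of its image under restriction of
  characters to \<open>F\<close>, which is a measure on a finite set.\<close>

lemma fourier_stieltjes_restriction:
  fixes \<Gamma> :: "('a, 'b) monoid_scheme"
  assumes "group \<Gamma>" "finite F" "torsion_set \<Gamma> F"
    and \<mu>: "complex_measure (borel_sets_of (dual_topology \<Gamma>)) \<mu>"
    and V: "measure_norm \<Gamma> \<mu> \<le> ennreal V" and \<gamma>: "\<gamma> \<in> F"
  shows "fourier_stieltjes \<Gamma> \<mu> \<gamma> =
    (\<Sum>k\<in>(\<lambda>x. restrict x F) ` characters \<Gamma>. cnj (k \<gamma>) * \<mu> {x \<in> characters \<Gamma>. restrict x F = k})"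
proof -
  have F: "F \<subseteq> carrier \<Gamma>" using assms(3) by (simp add: torsion_set_def)
  have "fourier_stieltjes \<Gamma> \<mu> \<gamma> =
      complex_integral (borel_sets_of (dual_topology \<Gamma>)) \<mu> (\<lambda>x. cnj (restrict x F \<gamma>))"
    using \<gamma> by (simp add: fourier_stieltjes_def)
  also have "\<dots> = (\<Sum>k\<in>(\<lambda>x. restrict x F) ` characters \<Gamma>. cnj (k \<gamma>) *
      \<mu> {x \<in> space (borel_sets_of (dual_topology \<Gamma>)). restrict x F = k})"
    using V restriction_fibre_measurable[OF assms(2) F]
    by (intro complex_integral_finite_range[where g = "\<lambda>k. cnj (k \<gamma>)" and q = "\<lambda>x. restrict x F", OF \<mu>]
         finite_restrict_characters[OF assms(1-3)])
       (auto simp: measure_norm_def)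
  finally show ?thesis by simp
qed

lemma sum_fibres_le_measure_norm:
  assumes "group \<Gamma>" "finite F" "torsion_set \<Gamma> F"
  shows "(\<Sum>k\<in>(\<lambda>x. restrict x F) ` characters \<Gamma>.
            ennreal (cmod (\<mu> {x \<in> characters \<Gamma>. restrict x F = k}))) \<le> measure_norm \<Gamma> \<mu>"
proof -
  define K where "K = (\<lambda>x. restrict x F) ` characters \<Gamma>"
  define fib where "fib k = {x \<in> characters \<Gamma>. restrict x F = k}" for k
  have F: "F \<subseteq> carrier \<Gamma>" using assms(3) by (simp add: torsion_set_def)
  have "fib ` K \<in> {P. finite P \<and> disjoint P \<and> P \<subseteq> sets (borel_sets_of (dual_topology \<Gamma>)) \<and>
      \<Union>P = topspace (dual_topology \<Gamma>)}"
  proof (intro CollectI conjI)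
    show "finite (fib ` K)"
      using finite_restrict_characters[OF assms] by (simp add: K_def)
    show "disjoint (fib ` K)"
      unfolding disjoint_def by (auto simp: fib_def)
    show "fib ` K \<subseteq> sets (borel_sets_of (dual_topology \<Gamma>))"
      unfolding fib_def using restriction_fibre_measurable[OF assms(2) F] by blast
    show "\<Union>(fib ` K) = topspace (dual_topology \<Gamma>)"
      unfolding fib_def K_def topspace_dual_topology by blast
  qed
  then have "(\<Sum>B\<in>fib ` K. ennreal (cmod (\<mu> B))) \<le> measure_norm \<Gamma> \<mu>"
    unfolding measure_norm_def total_variation_def by (rule SUP_upper)
  moreover have "(\<Sum>B\<in>fib ` K. ennreal (cmod (\<mu> B))) = (\<Sum>k\<in>K. ennreal (cmod (\<mu> (fib k))))"
  proof (rule sum.reindex[unfolded comp_def], rule inj_onI)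
    fix k k' assume "k \<in> K" "k' \<in> K" and eq: "fib k = fib k'"
    then obtain x where "x \<in> fib k" "restrict x F = k"
      by (auto simp: K_def fib_def)
    then show "k = k'"
      unfolding eq by (simp add: fib_def)
  qed
  ultimately show ?thesis
    by (simp only: K_def fib_def)
qed

lemma fourier_stieltjes_atomic:
  assumes "group \<Gamma>" "torsion_set \<Gamma> {\<gamma>}" "finite S" "S \<subseteq> characters \<Gamma>"
  shows "fourier_stieltjes \<Gamma> (atomic_measure S w) \<gamma> = (\<Sum>x\<in>S. w x * cnj (x \<gamma>))"
proof -
  define K where "K = (\<lambda>x. restrict x {\<gamma>}) ` characters \<Gamma>"
  have "measure_norm \<Gamma> (atomic_measure S w) \<le> ennreal (\<Sum>x\<in>S. cmod (w x))"
    using total_variation_atomic_le[OF assms(3), of _ w "characters \<Gamma>"] assms(4)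
    by (simp add: measure_norm_def Int_absorb2)
  then have "fourier_stieltjes \<Gamma> (atomic_measure S w) \<gamma> =
      (\<Sum>k\<in>K. cnj (k \<gamma>) * atomic_measure S w {x \<in> characters \<Gamma>. restrict x {\<gamma>} = k})"
    unfolding K_def using assms(1,2) by (intro fourier_stieltjes_restriction complex_measure_atomic assms(3)) auto
  also have "\<dots> = (\<Sum>k\<in>K. \<Sum>x\<in>{x\<in>S. restrict x {\<gamma>} = k}. w x * cnj (x \<gamma>))"
  proof (intro sum.cong refl)
    fix k
    have "S \<inter> {x \<in> characters \<Gamma>. restrict x {\<gamma>} = k} = {x\<in>S. restrict x {\<gamma>} = k}"
      using assms(4) by auto
    then have "cnj (k \<gamma>) * atomic_measure S w {x \<in> characters \<Gamma>. restrict x {\<gamma>} = k} =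
        (\<Sum>x\<in>{x\<in>S. restrict x {\<gamma>} = k}. cnj (k \<gamma>) * w x)"
      by (simp add: atomic_measure_def sum_distrib_left)
    also have "\<dots> = (\<Sum>x\<in>{x\<in>S. restrict x {\<gamma>} = k}. w x * cnj (x \<gamma>))"
      by (intro sum.cong) auto
    finally show "cnj (k \<gamma>) * atomic_measure S w {x \<in> characters \<Gamma>. restrict x {\<gamma>} = k} =
        (\<Sum>x\<in>{x\<in>S. restrict x {\<gamma>} = k}. w x * cnj (x \<gamma>))" .
  qed
  also have "\<dots> = (\<Sum>x\<in>S. w x * cnj (x \<gamma>))"
    using assms finite_restrict_characters[OF assms(1) _ assms(2)] by (intro sum.group) (auto simp: K_def)
  finally show ?thesis .
qed

lemma sidon_boundI:
  assumes "group \<Gamma>" "torsion_set \<Gamma> H" "0 \<le> C"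
    and interp: "\<And>\<phi> B. 0 \<le> B \<Longrightarrow> (\<And>\<gamma>. \<gamma> \<in> H \<Longrightarrow> cmod (\<phi> \<gamma>) \<le> B) \<Longrightarrow>
      \<exists>S w. finite S \<and> S \<subseteq> characters \<Gamma> \<and> (\<Sum>x\<in>S. cmod (w x)) \<le> C * B \<and>
        (\<forall>\<gamma>\<in>H. (\<Sum>x\<in>S. w x * cnj (x \<gamma>)) = \<phi> \<gamma>)"
  shows "sidon_bound \<Gamma> H C"
  unfolding sidon_bound_def
proof (intro conjI allI impI)
  fix \<phi> :: "'a \<Rightarrow> complex"
  assume "bounded (\<phi> ` H)"
  then obtain b where b: "\<And>\<gamma>. \<gamma> \<in> H \<Longrightarrow> cmod (\<phi> \<gamma>) \<le> b"
    by (auto simp: bounded_iff)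
  define s where "s = (SUP \<gamma>\<in>H. ennreal (cmod (\<phi> \<gamma>)))"
  have "s \<le> ennreal b"
    unfolding s_def using b by (intro SUP_least ennreal_leI)
  then have s: "ennreal (enn2real s) = s"
    by (intro ennreal_enn2real) (auto intro: le_less_trans)
  have "cmod (\<phi> \<gamma>) \<le> enn2real s" if "\<gamma> \<in> H" for \<gamma>
  proof -
    have "ennreal (cmod (\<phi> \<gamma>)) \<le> ennreal (enn2real s)"
      unfolding s using that by (auto simp: s_def intro: SUP_upper)
    then show ?thesis by (simp add: ennreal_le_iff)
  qed
  then obtain S w where S: "finite S" "S \<subseteq> characters \<Gamma>" "(\<Sum>x\<in>S. cmod (w x)) \<le> C * enn2real s"
      "\<And>\<gamma>. \<gamma> \<in> H \<Longrightarrow> (\<Sum>x\<in>S. w x * cnj (x \<gamma>)) = \<phi> \<gamma>"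
    using interp[of "enn2real s" \<phi>] by auto
  have "atomic_measure S w \<in> dual_measures \<Gamma>"
    unfolding dual_measures_def
    using S complex_measure_atomic regular_measure_atomic[OF t1_space_dual_topology S(1)] by auto
  moreover have "fourier_stieltjes \<Gamma> (atomic_measure S w) \<gamma> = \<phi> \<gamma>" if "\<gamma> \<in> H" for \<gamma>
    using fourier_stieltjes_atomic[OF assms(1) _ S(1,2), of \<gamma> w] S(4)[OF that] assms(2) that
    by (auto simp: torsion_set_def)
  moreover have "measure_norm \<Gamma> (atomic_measure S w) \<le> ennreal C * s"
  proof -
    have "measure_norm \<Gamma> (atomic_measure S w) \<le> ennreal (\<Sum>x\<in>S. cmod (w x))"
      using total_variation_atomic_le[OF S(1), of _ w "characters \<Gamma>"] S(2)
      by (simp add: measure_norm_def Int_absorb2)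
    also have "\<dots> \<le> ennreal (C * enn2real s)"
      using S(3) by (rule ennreal_leI)
    also have "\<dots> = ennreal C * s"
      using assms(3) s by (simp add: ennreal_mult)
    finally show ?thesis .
  qed
  ultimately show "\<exists>\<mu>\<in>dual_measures \<Gamma>. (\<forall>\<gamma>\<in>H. fourier_stieltjes \<Gamma> \<mu> \<gamma> = \<phi> \<gamma>) \<and>
      measure_norm \<Gamma> \<mu> \<le> ennreal C * (SUP \<gamma>\<in>H. ennreal (cmod (\<phi> \<gamma>)))"
    unfolding s_def by blast
qed (rule assms(3))

section \<open>Ratios of characters\<close>

text \<open>The values of the character \<open>x\<close> on the translate of \<open>F\<close> by the inverse of \<open>\<beta>\<close>. The value 1 outside
  \<open>F\<close> makes all these functions unimodular everywhere.\<close>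

definition ratio :: "'a set \<Rightarrow> 'a \<Rightarrow> ('a \<Rightarrow> complex) \<Rightarrow> 'a \<Rightarrow> complex" where
  "ratio F \<beta> x = (\<lambda>\<gamma>. if \<gamma> \<in> F then x \<gamma> * cnj (x \<beta>) else 1)"

definition ratios :: "('a, 'b) monoid_scheme \<Rightarrow> 'a set \<Rightarrow> 'a \<Rightarrow> ('a \<Rightarrow> complex) set" where
  "ratios \<Gamma> F \<beta> = ratio F \<beta> ` characters \<Gamma>"

lemma ratio_restrict: "\<beta> \<in> F \<Longrightarrow> ratio F \<beta> (restrict x F) = ratio F \<beta> x"
  by (auto simp: ratio_def)

lemma circle_valued_group_ratios:
  assumes "group \<Gamma>" "finite F" "torsion_set \<Gamma> F" "\<beta> \<in> F"
  shows "circle_valued_group (ratios \<Gamma> F \<beta>)"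
proof
  have F: "F \<subseteq> carrier \<Gamma>" using assms(3) by (simp add: torsion_set_def)
  have "ratios \<Gamma> F \<beta> = ratio F \<beta> ` (\<lambda>x. restrict x F) ` characters \<Gamma>"
    using ratio_restrict[OF assms(4)] by (auto simp: ratios_def image_image)
  then show "finite (ratios \<Gamma> F \<beta>)"
    using finite_restrict_characters[OF assms(1-3)] by simp
  show "ratios \<Gamma> F \<beta> \<noteq> {}"
    using one_mem_characters[OF assms(1)] by (auto simp: ratios_def)
  show "cmod (y \<gamma>) = 1" if "y \<in> ratios \<Gamma> F \<beta>" for y \<gamma>
    using that cmod_character[of _ \<Gamma>] subsetD[OF F] assms(4)
    by (auto simp: ratios_def ratio_def norm_mult)
  show "(\<lambda>\<gamma>. y \<gamma> * z \<gamma>) \<in> ratios \<Gamma> F \<beta>" if y: "y \<in> ratios \<Gamma> F \<beta>" and z: "z \<in> ratios \<Gamma> F \<beta>" for y z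
  proof -
    obtain u v where uv: "u \<in> characters \<Gamma>" "y = ratio F \<beta> u" "v \<in> characters \<Gamma>" "z = ratio F \<beta> v"
      using y z by (auto simp: ratios_def)
    then have "(\<lambda>\<gamma>. y \<gamma> * z \<gamma>) = ratio F \<beta> (\<lambda>\<gamma>\<in>carrier \<Gamma>. u \<gamma> * v \<gamma>)"
      using F assms(4) by (auto simp: ratio_def fun_eq_iff)
    then show ?thesis
      using mult_mem_characters[OF assms(1) uv(1,3)] by (auto simp: ratios_def)
  qed
qed

text \<open>The measure supplied by the Sidon property is first pushed to the restrictions of characters to \<open>F\<close>,
  then multiplied by \<open>cnj (k \<beta>)\<close> to undo the translation by \<open>\<beta>\<close>, and finally pushed to the ratios. No
  step increases the total mass.\<close>

lemma ratios_interpolate_signs: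
  assumes "group \<Gamma>" "finite F" "torsion_set \<Gamma> F" "\<beta> \<in> F" "F \<subseteq> E" and C: "sidon_bound \<Gamma> E C"
  shows "circle_valued_group.interpolates_signs (ratios \<Gamma> F \<beta>) F C"
proof -
  interpret circle_valued_group "ratios \<Gamma> F \<beta>"
    by (rule circle_valued_group_ratios[OF assms(1-4)])
  define K where "K = (\<lambda>x. restrict x F) ` characters \<Gamma>"
  have finK: "finite K"
    unfolding K_def by (rule finite_restrict_characters[OF assms(1-3)])
  have F: "F \<subseteq> carrier \<Gamma>" using assms(3) by (simp add: torsion_set_def)
  have unit: "cmod (k \<gamma>) = 1" if "k \<in> K" "\<gamma> \<in> F" for k \<gamma>
    using that F cmod_character[of _ \<Gamma>] by (auto simp: K_def)
  have ratio_K: "ratio F \<beta> ` K \<subseteq> ratios \<Gamma> F \<beta>"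
    using ratio_restrict[OF assms(4)] by (auto simp: ratios_def K_def)
  show ?thesis
    unfolding interpolates_signs_def
  proof (intro allI impI)
    fix \<epsilon> :: "'a \<Rightarrow> real"
    assume \<epsilon>: "\<forall>\<gamma>\<in>F. \<epsilon> \<gamma> \<in> {-1, 1}"
    define \<phi> where "\<phi> \<gamma> = (if \<gamma> \<in> F then complex_of_real (\<epsilon> \<gamma>) else 0)" for \<gamma>
    have \<phi>: "cmod (\<phi> \<gamma>) \<le> 1" for \<gamma>
      using \<epsilon> by (auto simp: \<phi>_def)
    then have "bounded (\<phi> ` E)"
      by (auto simp: bounded_iff)
    then obtain \<mu> where \<mu>: "\<mu> \<in> dual_measures \<Gamma>" "\<And>\<gamma>. \<gamma> \<in> E \<Longrightarrow> fourier_stieltjes \<Gamma> \<mu> \<gamma> = \<phi> \<gamma>"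
        "measure_norm \<Gamma> \<mu> \<le> ennreal C * (SUP \<gamma>\<in>E. ennreal (cmod (\<phi> \<gamma>)))"
      using C unfolding sidon_bound_def by blast
    have "0 \<le> C" using C by (simp add: sidon_bound_def)
    have "(SUP \<gamma>\<in>E. ennreal (cmod (\<phi> \<gamma>))) \<le> 1"
      using \<phi> by (intro SUP_least) simp
    then have norm: "measure_norm \<Gamma> \<mu> \<le> ennreal C"
      using \<mu>(3) mult_left_mono[of _ 1 "ennreal C"] by (metis mult.right_neutral order_trans zero_le)
    define \<rho> where "\<rho> k = \<mu> {x \<in> characters \<Gamma>. restrict x F = k}" for k
    have fourier: "(\<Sum>k\<in>K. cnj (k \<gamma>) * \<rho> k) = of_real (\<epsilon> \<gamma>)" if "\<gamma> \<in> F" for \<gamma>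
    proof -
      have "complex_measure (borel_sets_of (dual_topology \<Gamma>)) \<mu>"
        using \<mu>(1) by (simp add: dual_measures_def)
      then show ?thesis
        using fourier_stieltjes_restriction[OF assms(1-3) _ norm that] \<mu>(2)[of \<gamma>] that assms(5)
        by (auto simp: \<rho>_def K_def \<phi>_def)
    qed
    have mass: "(\<Sum>k\<in>K. cmod (\<rho> k)) \<le> C"
    proof -
      have "ennreal (\<Sum>k\<in>K. cmod (\<rho> k)) \<le> ennreal C"
        using sum_fibres_le_measure_norm[OF assms(1-3), of \<mu>] norm
        by (auto simp: \<rho>_def K_def intro: order_trans)
      then show ?thesis using \<open>0 \<le> C\<close> by (simp add: ennreal_le_iff)
    qed
    define \<nu> where "\<nu> y = (\<Sum>k\<in>{k\<in>K. ratio F \<beta> k = y}. \<rho> k * cnj (k \<beta>))" for y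
    have "(\<Sum>y\<in>ratios \<Gamma> F \<beta>. cmod (\<nu> y)) \<le>
        (\<Sum>y\<in>ratios \<Gamma> F \<beta>. \<Sum>k\<in>{k\<in>K. ratio F \<beta> k = y}. cmod (\<rho> k))"
      unfolding \<nu>_def using unit assms(4)
      by (intro sum_mono order_trans[OF norm_sum]) (simp add: norm_mult)
    also have "\<dots> = (\<Sum>k\<in>K. cmod (\<rho> k))"
      by (rule sum.group[OF finK finite_T ratio_K])
    finally have "(\<Sum>y\<in>ratios \<Gamma> F \<beta>. cmod (\<nu> y)) \<le> C"
      using mass by simp
    moreover have "(\<Sum>y\<in>ratios \<Gamma> F \<beta>. \<nu> y * cnj (y \<gamma>)) = of_real (\<epsilon> \<gamma>)" if \<gamma>: "\<gamma> \<in> F" for \<gamma>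
    proof -
      have "(\<Sum>y\<in>ratios \<Gamma> F \<beta>. \<nu> y * cnj (y \<gamma>)) =
          (\<Sum>y\<in>ratios \<Gamma> F \<beta>. \<Sum>k\<in>{k\<in>K. ratio F \<beta> k = y}. cnj (k \<gamma>) * \<rho> k)"
      proof (intro sum.cong refl)
        fix y
        have "\<rho> k * cnj (k \<beta>) * cnj (y \<gamma>) = cnj (k \<gamma>) * \<rho> k" if "k \<in> {k\<in>K. ratio F \<beta> k = y}" for k
        proof -
          have "cnj (k \<beta>) * k \<beta> = 1"
            using unit[of k \<beta>] that assms(4) by (simp add: mult.commute flip: complex_norm_square)
          moreover have "cnj (y \<gamma>) = cnj (k \<gamma>) * k \<beta>"
            using that \<gamma> by (auto simp: ratio_def)
          ultimately show ?thesis
            by (simp add: mult.assoc mult.left_commute)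
        qed
        then show "\<nu> y * cnj (y \<gamma>) = (\<Sum>k\<in>{k\<in>K. ratio F \<beta> k = y}. cnj (k \<gamma>) * \<rho> k)"
          unfolding \<nu>_def sum_distrib_right by (intro sum.cong refl)
      qed
      also have "\<dots> = (\<Sum>k\<in>K. cnj (k \<gamma>) * \<rho> k)"
        by (rule sum.group[OF finK finite_T ratio_K])
      finally show ?thesis
        using fourier[OF \<gamma>] by simp
    qed
    ultimately show "\<exists>\<nu>. (\<Sum>y\<in>ratios \<Gamma> F \<beta>. cmod (\<nu> y)) \<le> C \<and>
        (\<forall>\<gamma>\<in>F. (\<Sum>y\<in>ratios \<Gamma> F \<beta>. \<nu> y * cnj (y \<gamma>)) = of_real (\<epsilon> \<gamma>))"
      by blast
  qed
qed

text \<open>Each ratio lifts to a character \<open>x\<close>, and placing a point mass there, with weight multiplied by \<open>x \<beta>\<close>,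
  turns interpolation on the ratios into interpolation on the dual group.\<close>

lemma sidon_bound_of_independent:
  assumes "group \<Gamma>" "finite F" "torsion_set \<Gamma> F" "\<beta> \<in> F" "H \<subseteq> F" "1 \<le> n"
    and indep: "circle_valued_group.independent_of_degree (ratios \<Gamma> F \<beta>) (Suc n) H"
  shows "sidon_bound \<Gamma> H (1 + 1 / n)"
proof -
  interpret circle_valued_group "ratios \<Gamma> F \<beta>"
    by (rule circle_valued_group_ratios[OF assms(1-4)])
  define lift where "lift = inv_into (characters \<Gamma>) (ratio F \<beta>)"
  have lift: "lift y \<in> characters \<Gamma>" "ratio F \<beta> (lift y) = y" if "y \<in> ratios \<Gamma> F \<beta>" for y
    using that by (auto simp: lift_def ratios_def inv_into_into f_inv_into_f)
  have inj: "inj_on lift (ratios \<Gamma> F \<beta>)"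
    by (rule inj_on_inverseI[where g = "ratio F \<beta>"]) (rule lift(2))
  have F: "F \<subseteq> carrier \<Gamma>" using assms(3) by (simp add: torsion_set_def)
  have finH: "finite H" using assms(2,5) finite_subset by blast
  have tH: "torsion_set \<Gamma> H" using assms(3,5) by (auto simp: torsion_set_def)
  show ?thesis
  proof (rule sidon_boundI[OF assms(1) tH])
    fix \<phi> :: "'a \<Rightarrow> complex" and B :: real
    assume "0 \<le> B" "\<And>\<gamma>. \<gamma> \<in> H \<Longrightarrow> cmod (\<phi> \<gamma>) \<le> B"
    then obtain w where w: "(\<Sum>y\<in>ratios \<Gamma> F \<beta>. cmod (w y)) \<le> (1 + 1 / n) * B"
        "\<And>\<gamma>. \<gamma> \<in> H \<Longrightarrow> (\<Sum>y\<in>ratios \<Gamma> F \<beta>. w y * cnj (y \<gamma>)) = \<phi> \<gamma>"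
      using independent_interpolation[OF indep finH assms(6), of \<phi> B] by blast
    define W where "W x = w (ratio F \<beta> x) * x \<beta>" for x
    have "(\<Sum>x\<in>lift ` ratios \<Gamma> F \<beta>. cmod (W x)) = (\<Sum>y\<in>ratios \<Gamma> F \<beta>. cmod (w y))"
      using F assms(4) lift cmod_character[of _ \<Gamma> \<beta>]
      by (subst sum.reindex[OF inj]) (auto simp: W_def norm_mult intro!: sum.cong)
    moreover have "(\<Sum>x\<in>lift ` ratios \<Gamma> F \<beta>. W x * cnj (x \<gamma>)) = \<phi> \<gamma>" if "\<gamma> \<in> H" for \<gamma>
    proof -
      have "(\<Sum>x\<in>lift ` ratios \<Gamma> F \<beta>. W x * cnj (x \<gamma>)) = (\<Sum>y\<in>ratios \<Gamma> F \<beta>. w y * cnj (ratio F \<beta> (lift y) \<gamma>))"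
      proof (subst sum.reindex[OF inj], unfold comp_def, intro sum.cong refl)
        fix y assume "y \<in> ratios \<Gamma> F \<beta>"
        then show "W (lift y) * cnj (lift y \<gamma>) = w y * cnj (ratio F \<beta> (lift y) \<gamma>)"
          unfolding W_def lift(2)[OF \<open>y \<in> ratios \<Gamma> F \<beta>\<close>, THEN arg_cong[of _ _ w]]
          using that assms(5) by (auto simp: ratio_def)
      qed
      also have "\<dots> = \<phi> \<gamma>"
        using lift(2) w(2)[OF that] by simp
      finally show ?thesis .
    qed
    ultimately show "\<exists>S w. finite S \<and> S \<subseteq> characters \<Gamma> \<and> (\<Sum>x\<in>S. cmod (w x)) \<le> (1 + 1 / n) * B \<and>
        (\<forall>\<gamma>\<in>H. (\<Sum>x\<in>S. w x * cnj (x \<gamma>)) = \<phi> \<gamma>)"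
      using w(1) finite_T lift(1)
      by (intro exI[of _ "lift ` ratios \<Gamma> F \<beta>"] exI[of _ W]) auto
  qed simp
qed

lemma sidon_bound_singleton:
  assumes "group \<Gamma>" "torsion_set \<Gamma> {\<gamma>}" "1 \<le> C"
  shows "sidon_bound \<Gamma> {\<gamma>} C"
proof (rule sidon_boundI[OF assms(1,2)])
  fix \<phi> :: "'a \<Rightarrow> complex" and B :: real
  assume B: "0 \<le> B" "\<And>\<beta>. \<beta> \<in> {\<gamma>} \<Longrightarrow> cmod (\<phi> \<beta>) \<le> B"
  have "1 * B \<le> C * B"
    using assms(3) B(1) by (rule mult_right_mono)
  then show "\<exists>S w. finite S \<and> S \<subseteq> characters \<Gamma> \<and> (\<Sum>x\<in>S. cmod (w x)) \<le> C * B \<and>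
        (\<forall>\<beta>\<in>{\<gamma>}. (\<Sum>x\<in>S. w x * cnj (x \<beta>)) = \<phi> \<beta>)"
    using B(2)[of \<gamma>] assms(2)
    by (intro exI[of _ "{\<lambda>\<gamma>\<in>carrier \<Gamma>. 1}"] exI[of _ "\<lambda>_. \<phi> \<gamma>"])
       (auto simp: one_mem_characters[OF assms(1)] torsion_set_def)
qed (use assms(3) in simp)

lemma sidon_bound_empty: "group \<Gamma> \<Longrightarrow> 0 \<le> C \<Longrightarrow> sidon_bound \<Gamma> {} C"
  by (rule sidon_boundI) (auto simp: torsion_set_def intro!: exI[of _ "{}"])

lemma sidon_constant_le: "sidon_bound \<Gamma> E C \<Longrightarrow> sidon_constant \<Gamma> E \<le> ennreal C"
  unfolding sidon_constant_def by (intro Inf_lower) auto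

lemma proportional_subset_sidon_bound:
  fixes C \<delta> :: real
  assumes "group \<Gamma>" "finite F" "torsion_set \<Gamma> F" "\<beta> \<in> F" "F \<subseteq> E" and C: "sidon_bound \<Gamma> E C"
    and n: "1 \<le> n"
    and M: "\<And>\<gamma>. \<gamma> \<in> F \<Longrightarrow> \<gamma> [^]\<^bsub>\<Gamma>\<^esub> (M :: nat) = \<beta> [^]\<^bsub>\<Gamma>\<^esub> M"
    and coprime: "\<And>j. 1 \<le> j \<Longrightarrow> j \<le> Suc n \<Longrightarrow> coprime j M"
    and \<delta>: "0 < \<delta>" "2 * real (Suc n) * (exp 8 * \<delta>) \<le> 1" "16 * (real (Suc n))\<^sup>2 * C\<^sup>2 * exp 16 * \<delta> \<le> 1"
    and large: "8 / \<delta>\<^sup>2 \<le> card F"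
  shows "\<exists>H\<subseteq>F. \<delta> / 2 * card F \<le> card H \<and> sidon_bound \<Gamma> H (1 + 1 / n)"
proof -
  interpret circle_valued_group "ratios \<Gamma> F \<beta>"
    by (rule circle_valued_group_ratios[OF assms(1-4)])
  have F: "F \<subseteq> carrier \<Gamma>" using assms(3) by (simp add: torsion_set_def)
  have "y \<gamma> ^ M = 1" if "y \<in> ratios \<Gamma> F \<beta>" for y \<gamma>
  proof (cases "\<gamma> \<in> F")
    case True
    obtain x where x: "x \<in> characters \<Gamma>" "y = ratio F \<beta> x"
      using \<open>y \<in> ratios \<Gamma> F \<beta>\<close> by (auto simp: ratios_def)
    have "x \<gamma> ^ M = x \<beta> ^ M"
      using group.character_pow[OF assms(1) x(1), of \<gamma> M] group.character_pow[OF assms(1) x(1), of \<beta> M]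
        M[OF True] subsetD[OF F True] subsetD[OF F assms(4)] by simp
    moreover have "x \<beta> * cnj (x \<beta>) = 1"
      using cmod_character[OF x(1), of \<beta>] F assms(4) by (auto simp flip: complex_norm_square)
    ultimately have "(x \<gamma> * cnj (x \<beta>)) ^ M = 1"
      by (metis power_mult_distrib power_one)
    then show ?thesis
      using x True by (simp add: ratio_def)
  next
    case False
    then show ?thesis
      using that by (auto simp: ratios_def ratio_def)
  qed
  then have bij: "bij_betw (\<lambda>x \<gamma>. x \<gamma> ^ j) (ratios \<Gamma> F \<beta>) (ratios \<Gamma> F \<beta>)" if "1 \<le> j" "j \<le> Suc n" for j
    using bij_betw_power[of M j] coprime[OF that] that(1) by blast
  have "\<exists>H\<subseteq>F. \<delta> / 2 * card F \<le> card H \<and> independent_of_degree (Suc n) H"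
    by (rule proportional_independent_subset[OF assms(2) ratios_interpolate_signs[OF assms(1-5) C] _ bij \<delta> large])
       auto
  then show ?thesis
    using sidon_bound_of_independent[OF assms(1-4) _ n] by blast
qed

section \<open>Direct sums of cyclic groups of prime order\<close>

text \<open>The pigeonhole principle, with the large fibre given by one of its points.\<close>

lemma exists_large_fibre:
  assumes "finite F" "finite R" "f ` F \<subseteq> R" "F \<noteq> {}"
  obtains \<beta> where "\<beta> \<in> F" "card F \<le> card R * card {\<gamma>\<in>F. f \<gamma> = f \<beta>}"
proof -
  have "\<exists>\<beta>\<in>F. card F \<le> card R * card {\<gamma>\<in>F. f \<gamma> = f \<beta>}"
  proof (rule ccontr)
    assume contra: "\<not> ?thesis"
    have Rpos: "0 < card R"
      using assms by (auto simp: card_gt_0_iff)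
    have less: "card R * card {\<gamma>\<in>F. f \<gamma> = k} < card F" for k
    proof (cases "k \<in> f ` F")
      case True
      then show ?thesis using contra by (auto simp: not_le)
    next
      case False
      then have empty: "{\<gamma>\<in>F. f \<gamma> = k} = {}" by auto
      show ?thesis unfolding empty using assms(1,4) by (simp add: card_gt_0_iff)
    qed
    have "card F = (\<Sum>k\<in>R. \<Sum>\<gamma>\<in>{\<gamma>\<in>F. f \<gamma> = k}. 1)"
      unfolding sum.group[OF assms(1-3)] by simp
    then have "card R * card F = (\<Sum>k\<in>R. card R * card {\<gamma>\<in>F. f \<gamma> = k})"
      by (simp add: sum_distrib_left)
    also have "\<dots> < (\<Sum>k\<in>R. card F)"
      using Rpos assms(2) less by (intro sum_strict_mono) auto
    finally show False by simp
  qed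
  with that show thesis by blast
qed

definition cyclic_sum :: "(nat \<Rightarrow> nat) \<Rightarrow> (nat \<Rightarrow> int) monoid" where
  "cyclic_sum p = sum_group UNIV (\<lambda>i. integer_mod_group (p i))"

lemma group_cyclic_sum: "group (cyclic_sum p)"
  by (simp add: cyclic_sum_def)

lemma carrier_cyclic_sum:
  assumes "\<And>i. p i \<noteq> 0"
  shows "\<gamma> \<in> carrier (cyclic_sum p) \<longleftrightarrow> (\<forall>i. 0 \<le> \<gamma> i \<and> \<gamma> i < int (p i)) \<and> finite {i. \<gamma> i \<noteq> 0}"
  using assms by (auto simp: cyclic_sum_def carrier_sum_group carrier_integer_mod_group PiE_iff)

lemma pow_cyclic_sum:
  fixes n :: nat
  shows "\<gamma> [^]\<^bsub>cyclic_sum p\<^esub> n = (\<lambda>i. (int n * \<gamma> i) mod int (p i))"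
proof (induction n)
  case 0
  then show ?case
    by (simp add: cyclic_sum_def)
next
  case (Suc n)
  have "\<gamma> [^]\<^bsub>cyclic_sum p\<^esub> Suc n = (\<lambda>i. ((int n * \<gamma> i) mod int (p i) + \<gamma> i) mod int (p i))"
    by (simp add: Suc) (simp add: cyclic_sum_def restrict_def)
  then show ?case
    by (simp add: mod_add_left_eq mod_add_right_eq distrib_right add.commute)
qed

lemma torsion_cyclic_sum:
  assumes "\<And>i. p i \<noteq> 0"
  shows "torsion_set (cyclic_sum p) (carrier (cyclic_sum p))"
  unfolding torsion_set_def
proof (intro conjI ballI subset_refl)
  fix \<gamma> assume "\<gamma> \<in> carrier (cyclic_sum p)"
  then have fin: "finite {i. \<gamma> i \<noteq> 0}"
    by (simp add: carrier_cyclic_sum[OF assms])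
  define n where "n = (\<Prod>i\<in>{i. \<gamma> i \<noteq> 0}. p i)"
  have "(int n * \<gamma> i) mod int (p i) = 0" for i
  proof (cases "\<gamma> i = 0")
    case False
    then have "p i dvd n"
      unfolding n_def using fin by (intro dvd_prodI) auto
    then show ?thesis
      by (auto simp: mod_eq_0_iff_dvd)
  qed simp
  then have "\<gamma> [^]\<^bsub>cyclic_sum p\<^esub> n = \<one>\<^bsub>cyclic_sum p\<^esub>"
    unfolding pow_cyclic_sum by (simp add: cyclic_sum_def restrict_def)
  moreover have "0 < n"
    using assms by (auto simp: n_def intro!: prod_pos)
  ultimately show "\<exists>n::nat. 0 < n \<and> \<gamma> [^]\<^bsub>cyclic_sum p\<^esub> n = \<one>\<^bsub>cyclic_sum p\<^esub>"
    by blast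
qed

text \<open>Take \<open>M\<close> to be the product of the primes above \<open>m\<close> that occur in the supports of elements of \<open>F\<close>. Then
  \<open>M\<close>-th powers vanish in all coordinates with large primes, and in the others the elements of \<open>F\<close>
  already agree.\<close>

lemma common_power_coprime:
  assumes prime: "\<And>i. prime (p i)" and "finite F" "F \<subseteq> carrier (cyclic_sum p)"
    and same: "\<And>\<gamma> i. \<gamma> \<in> F \<Longrightarrow> p i \<le> m \<Longrightarrow> \<gamma> i = \<beta> i" and "\<beta> \<in> F"
  shows "\<exists>M :: nat. (\<forall>j. 1 \<le> j \<and> j \<le> m \<longrightarrow> coprime j M) \<and>
    (\<forall>\<gamma>\<in>F. \<gamma> [^]\<^bsub>cyclic_sum p\<^esub> M = \<beta> [^]\<^bsub>cyclic_sum p\<^esub> M)"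
proof -
  have p0: "p i \<noteq> 0" for i
    using prime[of i] by auto
  define I where "I = {i \<in> (\<Union>\<gamma>\<in>F. {i. \<gamma> i \<noteq> 0}). m < p i}"
  define M where "M = (\<Prod>i\<in>I. p i)"
  have "finite (\<Union>\<gamma>\<in>F. {i. \<gamma> i \<noteq> 0})"
    using assms(2,3) by (intro finite_UN_I) (auto simp: carrier_cyclic_sum[OF p0])
  then have finI: "finite I"
    by (rule rev_finite_subset) (auto simp: I_def)
  show ?thesis
  proof (intro exI[of _ M] conjI allI impI ballI)
    fix j assume j: "1 \<le> j \<and> j \<le> m"
    have "coprime j (p i)" if "i \<in> I" for i
    proof -
      have "\<not> p i dvd j"
        using that j dvd_imp_le[of "p i" j] by (auto simp: I_def)
      then show ?thesis
        using prime[of i] by (metis coprime_commute prime_imp_coprime)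
    qed
    then show "coprime j M"
      unfolding M_def by (rule prod_coprime_right)
  next
    fix \<gamma> assume \<gamma>: "\<gamma> \<in> F"
    show "\<gamma> [^]\<^bsub>cyclic_sum p\<^esub> M = \<beta> [^]\<^bsub>cyclic_sum p\<^esub> M"
      unfolding pow_cyclic_sum
    proof
      fix i
      consider "p i \<le> m" | "i \<in> I" | "\<gamma> i = 0" "\<beta> i = 0"
        using \<gamma> assms(5) not_le by (fastforce simp: I_def)
      then show "(int M * \<gamma> i) mod int (p i) = (int M * \<beta> i) mod int (p i)"
      proof cases
        case 1
        then show ?thesis using same[OF \<gamma>] by simp
      next
        case 2
        then have "p i dvd M"
          unfolding M_def using finI by (intro dvd_prodI) auto
        then have "int (p i) dvd int M * \<gamma> i" "int (p i) dvd int M * \<beta> i"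
          by auto
        then show ?thesis by simp
      qed simp
    qed
  qed
qed

theorem proposition4:
  fixes p :: "nat \<Rightarrow> nat" and E :: "(nat \<Rightarrow> int) set"
  assumes "\<And>i. prime (p i)"
    and "filterlim p at_top sequentially"
    and "sidon_set (sum_group UNIV (\<lambda>i. integer_mod_group (p i))) E"
  shows "\<forall>\<epsilon>>0::real. \<exists>\<delta>>0::real. \<forall>F. finite F \<and> F \<subseteq> E \<longrightarrow>
           (\<exists>H. finite H \<and> H \<subseteq> F \<and>
              sidon_constant (sum_group UNIV (\<lambda>i. integer_mod_group (p i))) H \<le> ennreal (1 + \<epsilon>) \<and>
              real (card H) \<ge> \<delta> * real (card F))"
  unfolding cyclic_sum_def[symmetric]
proof (intro allI impI)
  fix \<epsilon> :: real assume "0 < \<epsilon>"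
  have p0: "p i \<noteq> 0" for i
    using assms(1)[of i] by auto
  obtain C where E: "E \<subseteq> carrier (cyclic_sum p)" and C: "sidon_bound (cyclic_sum p) E C"
    using assms(3) by (auto simp: sidon_set_def cyclic_sum_def)
  note group = group_cyclic_sum[of p]
  have torsion: "torsion_set (cyclic_sum p) F" if "F \<subseteq> E" for F
    using torsion_cyclic_sum[OF p0] that E by (auto simp: torsion_set_def)
  obtain n :: nat where n: "1 \<le> n" "1 / real n < \<epsilon>"
    using \<open>0 < \<epsilon>\<close> by (metis One_nat_def Suc_leI nat_approx_posE zero_less_Suc)
  \<comment> \<open>The finitely many coordinates in which powers up to \<open>n + 1\<close> may fail to be injective.\<close>
  define S where "S = {i. p i \<le> Suc n}"
  have "eventually (\<lambda>i. Suc (Suc n) \<le> p i) sequentially"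
    using assms(2) by (simp add: filterlim_at_top)
  then obtain N where N: "\<And>i. N \<le> i \<Longrightarrow> Suc (Suc n) \<le> p i"
    by (auto simp: eventually_sequentially)
  have "S \<subseteq> {..<N}"
  proof
    fix i assume "i \<in> S"
    then have "p i < Suc (Suc n)" by (simp add: S_def)
    then show "i \<in> {..<N}" using N[of i] by (cases "N \<le> i") auto
  qed
  then have finS: "finite S"
    using finite_subset by blast
  define R where "R = (\<Pi>\<^sub>E i\<in>S. {0..<int (p i)})"
  have finR: "finite R"
    unfolding R_def using finS by (intro finite_PiE) auto
  have "(\<lambda>i\<in>S. 0) \<in> R"
    using p0 by (auto simp: R_def)
  then have Rpos: "0 < card R"
    using finR by (auto simp: card_gt_0_iff)
  define \<delta> where "\<delta> = 1 / (2 * real (Suc n) * exp 8 + 16 * (real (Suc n))\<^sup>2 * C\<^sup>2 * exp 16)"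
  have denominator: "0 < 2 * real (Suc n) * exp 8 + 16 * (real (Suc n))\<^sup>2 * C\<^sup>2 * exp 16"
    by (intro add_pos_nonneg) auto
  have \<delta>: "0 < \<delta>" "2 * real (Suc n) * (exp 8 * \<delta>) \<le> 1" "16 * (real (Suc n))\<^sup>2 * C\<^sup>2 * exp 16 * \<delta> \<le> 1"
    using denominator by (auto simp: \<delta>_def divide_simps)
  \<comment> \<open>The first term serves large classes of the pigeonhole partition, the second one small classes,
    where a single element is enough.\<close>
  define \<delta>' where "\<delta>' = min (\<delta> / (2 * card R)) (\<delta>\<^sup>2 / (8 * card R))"
  have "0 < \<delta>'"
    using \<delta>(1) Rpos by (simp add: \<delta>'_def)
  moreover have "\<exists>H. finite H \<and> H \<subseteq> F \<and> sidon_constant (cyclic_sum p) H \<le> ennreal (1 + \<epsilon>) \<and>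
      \<delta>' * real (card F) \<le> real (card H)" if F: "finite F \<and> F \<subseteq> E" for F
  proof -
    have "\<exists>H\<subseteq>F. sidon_bound (cyclic_sum p) H (1 + 1 / n) \<and> \<delta>' * card F \<le> card H"
    proof (cases "F = {}")
      case True
      then show ?thesis
        using sidon_bound_empty[OF group, of "1 + 1 / n"] by auto
    next
      case False
      have image: "(\<lambda>\<gamma>. restrict \<gamma> S) ` F \<subseteq> R"
        using F E carrier_cyclic_sum[OF p0] by (auto simp: R_def PiE_iff)
      obtain \<beta> where \<beta>: "\<beta> \<in> F" "card F \<le> card R * card {\<gamma>\<in>F. restrict \<gamma> S = restrict \<beta> S}"
        using exists_large_fibre[OF _ finR image False] F by blast
      define F' where "F' = {\<gamma>\<in>F. restrict \<gamma> S = restrict \<beta> S}"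
      have F': "finite F'" "F' \<subseteq> F" "\<beta> \<in> F'" "F' \<subseteq> E"
        using F \<beta>(1) by (auto simp: F'_def)
      have cardF: "real (card F) \<le> card R * card F'"
        using \<beta>(2) by (simp add: F'_def flip: of_nat_mult)
      show ?thesis
      proof (cases "8 / \<delta>\<^sup>2 \<le> card F'")
        case True
        have same: "\<gamma> i = \<beta> i" if "\<gamma> \<in> F'" "p i \<le> Suc n" for \<gamma> i
          using that by (auto simp: F'_def S_def restrict_def fun_eq_iff split: if_splits)
        have "\<exists>M :: nat. (\<forall>j. 1 \<le> j \<and> j \<le> Suc n \<longrightarrow> coprime j M) \<and>
            (\<forall>\<gamma>\<in>F'. \<gamma> [^]\<^bsub>cyclic_sum p\<^esub> M = \<beta> [^]\<^bsub>cyclic_sum p\<^esub> M)"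
          by (rule common_power_coprime[where p = p]) (fact assms(1) F'(1) subset_trans[OF F'(4) E] same F'(3))+
        then obtain M :: nat where M: "\<And>j. 1 \<le> j \<Longrightarrow> j \<le> Suc n \<Longrightarrow> coprime j M"
            "\<And>\<gamma>. \<gamma> \<in> F' \<Longrightarrow> \<gamma> [^]\<^bsub>cyclic_sum p\<^esub> M = \<beta> [^]\<^bsub>cyclic_sum p\<^esub> M"
          by blast
        have "\<exists>H\<subseteq>F'. \<delta> / 2 * card F' \<le> card H \<and> sidon_bound (cyclic_sum p) H (1 + 1 / n)"
          by (rule proportional_subset_sidon_bound[OF group F'(1) torsion[OF F'(4)] F'(3,4) C n(1) M(2,1) \<delta> True])
        then obtain H where H: "H \<subseteq> F'" "\<delta> / 2 * card F' \<le> card H" "sidon_bound (cyclic_sum p) H (1 + 1 / n)"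
          by blast
        have "\<delta>' * card F \<le> \<delta> / (2 * card R) * (card R * card F')"
          using \<open>0 < \<delta>'\<close> cardF by (intro mult_mono) (auto simp: \<delta>'_def)
        also have "\<dots> = \<delta> / 2 * card F'"
          using Rpos by simp
        finally show ?thesis
          using H F'(2) by (intro exI[of _ H]) auto
      next
        case False
        then have "\<delta>\<^sup>2 * card F' \<le> 8"
          using \<delta>(1) by (simp add: field_simps)
        have "\<delta>' * card F \<le> \<delta>\<^sup>2 / (8 * card R) * (card R * card F')"
          using \<open>0 < \<delta>'\<close> cardF by (intro mult_mono) (auto simp: \<delta>'_def)
        also have "\<dots> = \<delta>\<^sup>2 * card F' / 8"
          using Rpos by simp
        also have "\<dots> \<le> card {\<beta>}"
          using \<open>\<delta>\<^sup>2 * card F' \<le> 8\<close> by simp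
        finally show ?thesis
          using \<beta>(1) F torsion[of "{\<beta>}"] sidon_bound_singleton[OF group, of \<beta> "1 + 1 / n"]
          by (intro exI[of _ "{\<beta>}"]) auto
      qed
    qed
    then obtain H where H: "H \<subseteq> F" "sidon_bound (cyclic_sum p) H (1 + 1 / n)" "\<delta>' * card F \<le> card H"
      by blast
    have "sidon_constant (cyclic_sum p) H \<le> ennreal (1 + \<epsilon>)"
      using n(2) by (intro order_trans[OF sidon_constant_le[OF H(2)]] ennreal_leI) simp
    then show ?thesis
      using H F finite_subset by blast
  qed
  ultimately show "\<exists>\<delta>>0. \<forall>F. finite F \<and> F \<subseteq> E \<longrightarrow>
      (\<exists>H. finite H \<and> H \<subseteq> F \<and> sidon_constant (cyclic_sum p) H \<le> ennreal (1 + \<epsilon>) \<and>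
        \<delta> * real (card F) \<le> real (card H))"
    by blast
qed

end
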